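(* Let $\{A'_{n,m}\}_{n\ge3,\,1\le m\le n-2}$ be an admissible family, i.e. a family of finite sets of classes $A'_{n,m}\subset H_1(\mathrm{cell}(n,2);\mathbb{Q})$ such that for all $n\ge 3$ and $1\le m\le n-2$: (1) the elements of $A'_{n,m}$ are linearly independent and $|A'_{n,m}|=|A_{n,m}|$; (2) the $\mathbb{Q}$-span of $B_{n,0}\cup\bigcup_{1\le l\le m}(A'_{n,l}\cup B_{n,l})$ equals the $\mathbb{Q}$-span of $B_{n,0}\cup\bigcup_{1\le l\le m}(A_{n,l}\cup B_{n,l})$; (3) the $\mathbb{Q}$-span of $A'_{n,m}$ is the degree $n$ term of the $\mathrm{FI}_1$-submodule of $H_1(\mathrm{cell}(\bullet,2);\mathbb{Q})$ generated by the $\mathbb{Q}$-span of $A'_{m+2,m}$ and $[\iota_1]$, and this $\mathrm{FI}_1$-submodule is free; (4) the $\mathbb{Q}$-span of $A'_{m+2,m}$ is isomorphic to $\bigwedge^2\mathrm{Std}_{m+2}$ as an $S_{m+2}$-representation ($\mathrm{Std}_{m+2}$ the standard representation) and is a subrepresentation of the degree $m+2$ term of the $\mathrm{FI}_1$-submodule of $H_1(\mathrm{cell}(\bullet,2);\mathbb{Q})$ generated by the $\mathbb{Q}$-span of $A'_{3,1}$ and $[\iota_0]$. For $n\ge 3$ set $A'_{n}:=\bigcup_{m=1}^{n-2}A'_{n,m}$ and $B_n:=\bigcup_{m=0}^{n-2}B_{n,m}$. Then $A'_{n}\cup B_{n}$ is a basis for $H_{1}\big(\mathrm{cell}(n,2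);\mathbb{Q}\big)$.
   Context: Cells. A symbol on a finite set $S$ of positive integers (labels) is a sequence $\alpha_1|\cdots|\alpha_r$ of nonempty blocks, each a string of labels, with every element of $S$ occurring exactly once. $\mathrm{cell}(S)$ is the polyhedral cell complex with one cell of dimension $|S|-r$ for each symbol on $S$ with $r$ blocks; $f$ is a face of $g$ iff the symbol of $g$ is obtained from that of $f$ by deleting bars and shuffling the merged blocks (keeping the internal order of each original block). $\mathrm{cell}(S,2)$ is the subcomplex of cells all of whose blocks have at most $2$ elements; $\mathrm{cell}(n)=\mathrm{cell}([n])$, $\mathrm{cell}(n,2)=\mathrm{cell}([n],2)$, $[n]=\{1,\dots,n\}$. The boundary of a one-block cell $g$ is $\sum \pm\,\alpha|\beta$ over all ways to split $g$ into two complementary nonempty subwords $\alpha,\beta$, the sign being that of the permutation taking the word $g$ to the word $\alpha\beta$; and $\partial(g_1|g_2)=\partial g_1|g_2+(-1)^{b(g_1)}g_1|\partial g_2$ with $b$ the number of blocks. $S_n$ acts by permuting labels, so $H_k(\mathrm{cell}(n,2);\mathbb{Q})$ is an $S_n$-representation. The concatenation product $z_1|z_2$ of cycles on disjoint label sets is the bilinear extension of concatenation of symbols. Basis. A singleton is a one-element block; a block is a follower if the preceding block is a singleton whose element is less than every element of the block. A symbol $e$ on $[n]$ is critical if its blocks have at most $2$ elements, every two consecutive singletons are in decreasing order, and every $2$-element block with decreasing elements is a follower. Put $z(i)=i$; $z(a\,b)=a\,b+b\,a$ for $a<b$; and for $a<b<c$ let $z(a|c\,b)$ be the image, under the order-preserving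 relabeling $1,2,3\mapsto a,b,c$, of $z(1|3\,2):=\partial(3\,2\,1)$ (boundary taken in $\mathrm{cell}(3)$). A critical symbol is uniquely a concatenation of pieces $i$; $a\,b$ ($a<b$); $a|c\,b$ ($a<b<c$), and $z(e)$ is the concatenation product of the corresponding cycles. By a theorem of Alpert the classes $z(e)$, $e$ critical with exactly $k$ two-element blocks, form a basis of $H_k(\mathrm{cell}(n,2);\mathbb{Q})$. Sets. For $n\ge3$, $1\le m\le n-2$, $A_{n,m}$ is the set of basis elements $z(e)$ of $H_1(\mathrm{cell}(n,2);\mathbb{Q})$ with $e=i_{1}|\cdots|i_{m}|i_{m+1}\,i_{m+2}|i_{m+3}|\cdots|i_{n}$, the $i_j$ a permutation of $[n]$, $i_1>\cdots>i_m$, $i_{m+3}>\cdots>i_n$, $i_{m+1}>i_{m+2}>i_m$. For $n\ge2$, $0\le m\le n-2$, $B_{n,m}$ is the set of those with $e$ of the same shape, $i_1>\cdots>i_m$, $i_{m+3}>\cdots>i_n$, $i_{m+2}>i_{m+1}$. High insertion. The barriers of a critical $e$ are its pieces of type $a\,b$ and $a|c\,b$; for $0\le j\le k$ ($k$ the number of barriers) $\iota_j(e)$ is the critical symbol obtained by inserting the singleton block $n+1$ immediately after the $j$-th barrier (at the far left if $j=0$), and $[\iota_j]:H_k(\mathrm{cell}(n,2);\mathbb{Q})\to H_k(\mathrm{cell}(n+1,2);\mathbb{Q})$ is linear with $z(e)\mapsto z(\iota_j(e))$. $\mathrm{FI}_1=\mathrm{FI}$ is the category of the sets $[n]$ and injections;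 an $\mathrm{FI}_1$-module over $\mathbb{Q}$ is a functor to $\mathbb{Q}$-vector spaces; it is free if isomorphic to a direct sum of modules $\mathbb{Q}[\mathrm{Hom}_{\mathrm{FI}}([m],\bullet)]\otimes_{\mathbb{Q}[S_m]}U_m$ with $U_m$ an $S_m$-representation. By work of Alpert, $H_1(\mathrm{cell}(\bullet,2);\mathbb{Q})$ with either one of the maps $[\iota_0]$, $[\iota_1]$ (as the map induced by the standard inclusion $[n]\to[n+1]$) is an $\mathrm{FI}_1$-module. The submodule generated by a subspace $V$ and a chosen map is the smallest sequence of $S_n$-subrepresentations containing $V$ and closed under that map. *)

theory Defs
  imports
    Complex_Main
    "HOL-Library.Poly_Mapping"
    "HOL-Library.FuncSet"
    "HOL-Combinatorics.Permutations"
begin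

section \<open>Finitely supported functions\<close>

text \<open>\<open>'a \<Rightarrow>\<^sub>0 'b\<close> serves as \<open>\<rat>['a] \<otimes> 'b\<close>, the element \<open>single x u\<close> being \<open>x \<otimes> u\<close>;
  \<open>s\<close> is the scalar multiplication of \<open>'b\<close>.\<close>

abbreviation keys :: "('a \<Rightarrow>\<^sub>0 'b::zero) \<Rightarrow> 'a set"
  where "keys \<equiv> Poly_Mapping.keys"

abbreviation lookup :: "('a \<Rightarrow>\<^sub>0 'b::zero) \<Rightarrow> 'a \<Rightarrow> 'b"
  where "lookup \<equiv> poly_mapping.lookup"

abbreviation single :: "'a \<Rightarrow> 'b \<Rightarrow> ('a \<Rightarrow>\<^sub>0 'b::zero)"
  where "single \<equiv> Poly_Mapping.single"

definition pm_scale :: "(rat \<Rightarrow> 'b \<Rightarrow> 'b) \<Rightarrow> rat \<Rightarrow> ('a \<Rightarrow>\<^sub>0 'b) \<Rightarrow> ('a \<Rightarrow>\<^sub>0 'b::ab_group_add)"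
  where "pm_scale s q c = Poly_Mapping.map (s q) c"

abbreviation qscale :: "rat \<Rightarrow> ('a \<Rightarrow>\<^sub>0 rat) \<Rightarrow> ('a \<Rightarrow>\<^sub>0 rat)"
  where "qscale \<equiv> pm_scale (*)"

definition push :: "('a \<Rightarrow> 'c) \<Rightarrow> ('a \<Rightarrow>\<^sub>0 'b) \<Rightarrow> ('c \<Rightarrow>\<^sub>0 'b::ab_group_add)"
  where "push g c = (\<Sum>x\<in>keys c. single (g x) (lookup c x))"

definition lin_ext :: "('a \<Rightarrow> ('c \<Rightarrow>\<^sub>0 rat)) \<Rightarrow> ('a \<Rightarrow>\<^sub>0 rat) \<Rightarrow> ('c \<Rightarrow>\<^sub>0 rat)"
  where "lin_ext f c = (\<Sum>x\<in>keys c. qscale (lookup c x) (f x))"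

lemma lookup_qscale [simp]: "lookup (qscale q c) x = q * lookup c x"
  unfolding pm_scale_def by transfer (auto simp: when_def)

lemma qscale_vector_space: "vector_space (qscale :: rat \<Rightarrow> ('a \<Rightarrow>\<^sub>0 rat) \<Rightarrow> _)"
  by unfold_locales (auto intro!: poly_mapping_eqI simp: lookup_add algebra_simps)

interpretation qs: vector_space "qscale :: rat \<Rightarrow> ('a \<Rightarrow>\<^sub>0 rat) \<Rightarrow> _"
  by (rule qscale_vector_space)

lemma lin_ext_superset:
  assumes "finite K" "keys c \<subseteq> K"
  shows "lin_ext f c = (\<Sum>x\<in>K. qscale (lookup c x) (f x))"
  unfolding lin_ext_def using assms
  by (intro sum.mono_neutral_left) (auto simp: in_keys_iff)

lemma lin_ext_add: "lin_ext f (c + d) = lin_ext f c + lin_ext f d"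
proof -
  let ?K = "keys c \<union> keys d"
  have "lin_ext f (c + d) = (\<Sum>x\<in>?K. qscale (lookup (c + d) x) (f x))"
    by (rule lin_ext_superset) (auto simp: keys_add)
  moreover have "lin_ext f c = (\<Sum>x\<in>?K. qscale (lookup c x) (f x))"
    by (rule lin_ext_superset) auto
  moreover have "lin_ext f d = (\<Sum>x\<in>?K. qscale (lookup d x) (f x))"
    by (rule lin_ext_superset) auto
  ultimately show ?thesis
    by (simp add: lookup_add qs.scale_left_distrib sum.distrib)
qed

lemma lin_ext_scale: "lin_ext f (qscale q c) = qscale q (lin_ext f c)"
proof -
  have "keys (qscale q c) \<subseteq> keys c"
    by (auto simp: in_keys_iff)
  hence "lin_ext f (qscale q c) = (\<Sum>x\<in>keys c. qscale (lookup (qscale q c) x) (f x))"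
    by (intro lin_ext_superset) auto
  thus ?thesis
    by (simp add: lin_ext_def qs.scale_sum_right)
qed

lemma lin_ext_linear: "Vector_Spaces.linear qscale qscale (lin_ext f)"
  by unfold_locales (simp_all add: lin_ext_add lin_ext_scale)

lemma push_conv_lin_ext:
  fixes g :: "'a \<Rightarrow> 'c" and c :: "'a \<Rightarrow>\<^sub>0 rat"
  shows "push g c = lin_ext (\<lambda>x. single (g x) 1) c"
proof -
  have "single y q = qscale q (single y 1)" for y :: 'c and q
    by (rule poly_mapping_eqI) (simp add: lookup_single when_def)
  thus ?thesis
    unfolding push_def lin_ext_def by (intro sum.cong refl)
qed


section \<open>The cell complex\<close>

text \<open>A symbol is the list of its blocks.\<close>

type_synonym symbol = "nat list list"
type_synonym chain = "symbol \<Rightarrow>\<^sub>0 rat"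

definition is_symbol :: "symbol \<Rightarrow> bool"
  where "is_symbol e \<longleftrightarrow> [] \<notin> set e \<and> distinct (concat e)"

definition cells2 :: "nat set \<Rightarrow> nat \<Rightarrow> symbol set"
  where "cells2 S k = {e. is_symbol e \<and> set (concat e) = S \<and> (\<forall>g\<in>set e. length g \<le> 2)
                          \<and> length e + k = card S}"

text \<open>Sign of the permutation of positions taking the word \<open>g\<close> to the word \<open>h\<close>.\<close>

definition word_sign :: "nat list \<Rightarrow> nat list \<Rightarrow> rat"
  where "word_sign g h =
    of_int (sign (THE p. p permutes {..<length g} \<and> permute_list p g = h))"

text \<open>The labels of a block being distinct, its subwords correspond to the subsets of its label set.\<close>

definition bd_block :: "nat list \<Rightarrow> chain"
  where "bd_block g = (\<Sum>A | A \<subset> set g \<and> A \<noteq> {}.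
     let a = filter (\<lambda>x. x \<in> A) g; b = filter (\<lambda>x. x \<notin> A) g
     in single [a, b] (word_sign g (a @ b)))"

definition cat :: "chain \<Rightarrow> chain \<Rightarrow> chain"
  where "cat x y = (\<Sum>e\<in>keys x. \<Sum>f\<in>keys y. single (e @ f) (lookup x e * lookup y f))"

text \<open>The rule \<open>\<partial>(g\<^sub>1|g\<^sub>2) = \<partial>g\<^sub>1|g\<^sub>2 + (-1)\<^bsup>b\<^esup> g\<^sub>1|\<partial>g\<^sub>2\<close>, \<open>b\<close> the number of blocks of \<open>g\<^sub>1\<close>, is applied with \<open>b = 1\<close>.\<close>

primrec bd_symbol :: "symbol \<Rightarrow> chain"
  where
    "bd_symbol [] = 0"
  | "bd_symbol (g # e) = cat (bd_block g) (single e 1)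
                         - cat (single [g] 1) (bd_symbol e)"

definition bd :: "chain \<Rightarrow> chain"
  where "bd = lin_ext bd_symbol"

definition relabel :: "(nat \<Rightarrow> nat) \<Rightarrow> chain \<Rightarrow> chain"
  where "relabel \<sigma> = push (map (map \<sigma>))"

definition cycles :: "nat set \<Rightarrow> nat \<Rightarrow> chain set"
  where "cycles S k = {c. keys c \<subseteq> cells2 S k \<and> bd c = 0}"

definition boundaries :: "nat set \<Rightarrow> nat \<Rightarrow> chain set"
  where "boundaries S k = bd ` {c. keys c \<subseteq> cells2 S (Suc k)}"


section \<open>Homology\<close>

text \<open>In order that homology classes of all the complexes \<open>cell(S,2)\<close> form a single vector space
  type, chains are taken modulo \<open>bd_all\<close>, the sum of the boundaries of all these complexes.
  \<open>H\<^sub>k(cell(S,2))\<close> is the subspace of classes of \<open>cycles S k\<close>; by \<open>cls_eq_iff\<close>, it is exactly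
  \<open>cycles S k\<close> modulo \<open>boundaries S k\<close>.\<close>

definition bd_all :: "chain set"
  where "bd_all = bd ` {c. \<forall>e\<in>keys c. is_symbol e \<and> (\<forall>g\<in>set e. length g \<le> 2)}"

definition homologous :: "chain \<Rightarrow> chain \<Rightarrow> bool"
  where "homologous c d \<longleftrightarrow> c - d \<in> bd_all"

lemma bd_linear: "Vector_Spaces.linear qscale qscale bd"
  unfolding bd_def by (rule lin_ext_linear)

interpretation bd: Vector_Spaces.linear qscale qscale bd
  by (rule bd_linear)

lemma subspace_bd_all: "qs.subspace bd_all"
  unfolding bd_all_def
proof (rule bd.subspace_image, rule qs.subspaceI)
  fix x y :: chain and q :: rat
  let ?C = "{c :: chain. \<forall>e\<in>keys c. is_symbol e \<and> (\<forall>g\<in>set e. length g \<le> 2)}"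
  show "0 \<in> ?C" by simp
  show "x + y \<in> ?C" if "x \<in> ?C" "y \<in> ?C"
    using that keys_add[of x y] by blast
  show "qscale q x \<in> ?C" if "x \<in> ?C"
    using that by (auto simp: in_keys_iff)
qed

lemma homologous_refl: "homologous c c"
  using qs.subspace_0[OF subspace_bd_all] by (simp add: homologous_def)

lemma homologous_add: "homologous a b \<Longrightarrow> homologous c d \<Longrightarrow> homologous (a + c) (b + d)"
  using qs.subspace_add[OF subspace_bd_all, of "a - b" "c - d"]
  by (simp add: homologous_def algebra_simps)

lemma homologous_scale: "homologous a b \<Longrightarrow> homologous (qscale q a) (qscale q b)"
  using qs.subspace_scale[OF subspace_bd_all, of "a - b" q]
  by (simp add: homologous_def qs.scale_right_diff_distrib)

lemma homologous_uminus: "homologous a b \<Longrightarrow> homologous (- a) (- b)"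
  using qs.subspace_neg[OF subspace_bd_all, of "a - b"]
  by (simp add: homologous_def algebra_simps)

lemma homologous_diff: "homologous a b \<Longrightarrow> homologous c d \<Longrightarrow> homologous (a - c) (b - d)"
  using homologous_add[OF _ homologous_uminus, of a b c d] by simp

lemma homologous_sym: "homologous a b \<Longrightarrow> homologous b a"
  using qs.subspace_neg[OF subspace_bd_all, of "a - b"] by (simp add: homologous_def)

lemma homologous_trans: "homologous a b \<Longrightarrow> homologous b c \<Longrightarrow> homologous a c"
  using qs.subspace_add[OF subspace_bd_all, of "a - b" "b - c"] by (simp add: homologous_def)

quotient_type hclass = chain / homologous
  morphisms rep_cls cls
  by (intro equivpI reflpI sympI transpI homologous_refl)
     (blast intro: homologous_sym homologous_trans)+

instantiation hclass :: ab_group_add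
begin

lift_definition zero_hclass :: hclass is "0 :: chain" .

lift_definition plus_hclass :: "hclass \<Rightarrow> hclass \<Rightarrow> hclass" is "(+) :: chain \<Rightarrow> _"
  by (rule homologous_add)

lift_definition uminus_hclass :: "hclass \<Rightarrow> hclass" is "uminus :: chain \<Rightarrow> _"
  by (rule homologous_uminus)

lift_definition minus_hclass :: "hclass \<Rightarrow> hclass \<Rightarrow> hclass" is "(-) :: chain \<Rightarrow> _"
  by (rule homologous_diff)

instance
  by (standard; transfer) (simp_all add: algebra_simps homologous_refl)

end

lift_definition hscale :: "rat \<Rightarrow> hclass \<Rightarrow> hclass" is "qscale :: rat \<Rightarrow> chain \<Rightarrow> chain"
  by (rule homologous_scale)

lemma hscale_vector_space: "vector_space hscale"
  by (unfold_locales; transfer)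
     (simp_all add: homologous_refl qs.scale_right_distrib qs.scale_left_distrib)

interpretation hv: vector_space hscale
  by (rule hscale_vector_space)

definition homology :: "nat set \<Rightarrow> nat \<Rightarrow> hclass set"
  where "homology S k = cls ` cycles S k"

abbreviation H1 :: "nat \<Rightarrow> hclass set"
  where "H1 n \<equiv> homology {1..n} 1"


lemma keys_sum_subset:
  assumes "z \<in> keys (\<Sum>x\<in>A. F x)"
  shows "\<exists>x\<in>A. z \<in> keys (F x)"
proof (rule ccontr)
  assume "\<not> ?thesis"
  hence "(\<Sum>x\<in>A. lookup (F x) z) = 0" by (intro sum.neutral) (auto simp: in_keys_iff)
  with assms show False by (simp add: in_keys_iff lookup_sum)
qed

lemma keys_lin_ext:
  assumes "z \<in> keys (lin_ext F c)"
  shows "\<exists>x\<in>keys c. z \<in> keys (F x)"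
proof -
  obtain x where "x \<in> keys c" "z \<in> keys (qscale (lookup c x) (F x))"
    using keys_sum_subset[OF assms[unfolded lin_ext_def]] by blast
  thus ?thesis by (auto simp: in_keys_iff)
qed

lemma keys_cat:
  assumes "z \<in> keys (cat x y)"
  shows "\<exists>e\<in>keys x. \<exists>f\<in>keys y. z = e @ f"
proof -
  obtain e where "e \<in> keys x"
    and "z \<in> keys (\<Sum>f\<in>keys y. single (e @ f) (lookup x e * lookup y f))"
    using keys_sum_subset[OF assms[unfolded cat_def]] by blast
  moreover from keys_sum_subset[OF this(2)] obtain f where "f \<in> keys y"
    and "z \<in> keys (single (e @ f) (lookup x e * lookup y f))"
    by blast
  ultimately show ?thesis by (auto split: if_splits)
qed

lemma keys_bd_block:
  assumes "z \<in> keys (bd_block g)"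
  shows "\<exists>A. A \<subset> set g \<and> A \<noteq> {} \<and> z = [filter (\<lambda>x. x \<in> A) g, filter (\<lambda>x. x \<notin> A) g]"
proof -
  from keys_sum_subset[OF assms[unfolded bd_block_def]] obtain A
    where "A \<subset> set g \<and> A \<noteq> {}"
    and "z \<in> keys (let a = filter (\<lambda>x. x \<in> A) g; b = filter (\<lambda>x. x \<notin> A) g
                     in single [a, b] (word_sign g (a @ b)))"
    by blast
  thus ?thesis by (intro exI[of _ A]) (simp add: Let_def split: if_splits)
qed

lemma keys_bd_symbol:
  assumes "is_symbol e" "f \<in> keys (bd_symbol e)"
  shows "is_symbol f \<and> set (concat f) = set (concat e) \<and> length f = Suc (length e)
         \<and> ((\<forall>g\<in>set e. length g \<le> 2) \<longrightarrow> (\<forall>g\<in>set f. length g \<le> 2))"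
  using assms
proof (induction e arbitrary: f)
  case (Cons g e)
  have sym: "is_symbol e" "distinct g" "g \<noteq> []" "set g \<inter> set (concat e) = {}"
    using Cons.prems(1) by (auto simp: is_symbol_def)
  have "keys (a - b) \<subseteq> keys a \<union> keys b" for a b :: chain
    by (auto simp: in_keys_iff lookup_minus)
  then consider "f \<in> keys (cat (bd_block g) (single e 1))" | "f \<in> keys (cat (single [g] 1) (bd_symbol e))"
    using Cons.prems(2) by auto
  thus ?case
  proof cases
    case 1
    from keys_cat[OF this] obtain z where "z \<in> keys (bd_block g)" and f: "f = z @ e"
      by (auto split: if_splits)
    from keys_bd_block[OF this(1)] obtain A where A: "A \<subset> set g" "A \<noteq> {}"
      and z: "z = [filter (\<lambda>x. x \<in> A) g, filter (\<lambda>x. x \<notin> A) g]" by blast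
    have "length (filter P g) \<le> 2" if "length g \<le> 2" for P
      using that length_filter_le order_trans by blast
    moreover have "filter (\<lambda>x. x \<in> A) g \<noteq> []" "filter (\<lambda>x. x \<notin> A) g \<noteq> []"
      using A by (auto simp: filter_empty_conv)
    ultimately show ?thesis
      using sym unfolding f z is_symbol_def by auto
  next
    case 2
    from keys_cat[OF this] obtain z where "z \<in> keys (bd_symbol e)" and f: "f = g # z"
      by (auto split: if_splits)
    with Cons.IH[OF sym(1)] sym show ?thesis
      by (auto simp: is_symbol_def)
  qed
qed simp

lemma cells2_bd_iff:
  assumes "is_symbol e" "\<forall>g\<in>set e. length g \<le> 2" "f \<in> keys (bd_symbol e)"
  shows "f \<in> cells2 S k \<longleftrightarrow> e \<in> cells2 S (Suc k)"
proof -
  note * = keys_bd_symbol[OF assms(1,3)]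
  hence "is_symbol f" "\<forall>g\<in>set f. length g \<le> 2" "set (concat f) = set (concat e)"
    "length f + k = length e + Suc k"
    using assms(2) by simp_all
  thus ?thesis using assms(1,2) unfolding cells2_def by simp
qed

lemma boundaries_conv: "{c \<in> bd_all. keys c \<subseteq> cells2 S k} = boundaries S k"
proof (intro equalityI subsetI)
  fix c assume "c \<in> boundaries S k"
  then obtain x where x: "c = bd x" "keys x \<subseteq> cells2 S (Suc k)"
    by (auto simp: boundaries_def)
  have "c \<in> bd_all"
    using x by (force simp: bd_all_def cells2_def)
  moreover have "f \<in> cells2 S k" if "f \<in> keys c" for f
  proof -
    from keys_lin_ext[OF that[unfolded x(1) bd_def]]
    obtain e where e: "e \<in> keys x" "f \<in> keys (bd_symbol e)" by blast
    moreover have "e \<in> cells2 S (Suc k)" using e x by auto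
    ultimately show ?thesis
      using cells2_bd_iff[of e f S k] by (auto simp: cells2_def)
  qed
  ultimately show "c \<in> {c \<in> bd_all. keys c \<subseteq> cells2 S k}" by blast
next
  fix c assume "c \<in> {c \<in> bd_all. keys c \<subseteq> cells2 S k}"
  then obtain x where x: "c = bd x" "keys c \<subseteq> cells2 S k"
    "\<forall>e\<in>keys x. is_symbol e \<and> (\<forall>g\<in>set e. length g \<le> 2)"
    by (auto simp: bd_all_def)
  define y where "y = (\<Sum>e\<in>keys x \<inter> cells2 S (Suc k). single e (lookup x e))"
  have ly: "lookup y e = (if e \<in> cells2 S (Suc k) then lookup x e else 0)" for e
    by (auto simp: y_def lookup_sum lookup_single when_def in_keys_iff)
  have ky: "keys y \<subseteq> cells2 S (Suc k)"
    by (auto simp: in_keys_iff ly split: if_splits)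
  have "lookup (bd x) f = lookup (bd y) f" for f
  proof (cases "f \<in> cells2 S k")
    case True
    have "f \<notin> keys (bd (x - y))"
    proof
      assume "f \<in> keys (bd (x - y))"
      from keys_lin_ext[OF this[unfolded bd_def]]
      obtain e where e: "e \<in> keys (x - y)" "f \<in> keys (bd_symbol e)" by blast
      hence "e \<in> keys x" "e \<notin> cells2 S (Suc k)"
        by (auto simp: in_keys_iff lookup_minus ly split: if_splits)
      thus False using cells2_bd_iff[of e f S k] e True x(3) by blast
    qed
    thus ?thesis by (simp add: in_keys_iff bd.diff lookup_minus)
  next
    case False
    have "f \<notin> keys (bd y)"
    proof
      assume "f \<in> keys (bd y)"
      from keys_lin_ext[OF this[unfolded bd_def]]
      obtain e where e: "e \<in> keys y" "f \<in> keys (bd_symbol e)" by blast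
      moreover have "e \<in> cells2 S (Suc k)" using e ky by auto
      ultimately show False
        using cells2_bd_iff[of e f S k] False by (auto simp: cells2_def)
    qed
    moreover have "f \<notin> keys (bd x)" using False x by auto
    ultimately show ?thesis by (simp add: in_keys_iff)
  qed
  hence "c = bd y" unfolding x(1) by (rule poly_mapping_eqI)
  thus "c \<in> boundaries S k" using ky by (auto simp: boundaries_def)
qed

lemma cls_eq_iff:
  assumes "c \<in> cycles S k" "d \<in> cycles S k"
  shows "cls c = cls d \<longleftrightarrow> c - d \<in> boundaries S k"
proof -
  have "keys (c - d) \<subseteq> cells2 S k"
  proof
    fix f assume "f \<in> keys (c - d)"
    hence "f \<in> keys c \<or> f \<in> keys d" by (auto simp: in_keys_iff lookup_minus)
    thus "f \<in> cells2 S k" using assms unfolding cycles_def by blast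
  qed
  hence "c - d \<in> boundaries S k \<longleftrightarrow> c - d \<in> bd_all"
    using boundaries_conv by blast
  thus ?thesis by (simp only: hclass.abs_eq_iff homologous_def)
qed


text \<open>The value does not depend on the representative, see \<open>hact_cls\<close>.\<close>

definition hact :: "(nat \<Rightarrow> nat) \<Rightarrow> hclass \<Rightarrow> hclass"
  where "hact \<sigma> h = cls (relabel \<sigma> (rep_cls h))"

lemma single_conv: "single y q = qscale q (single y 1)"
  by (rule poly_mapping_eqI) (simp add: lookup_single when_def)

lemma lin_ext_single [simp]: "lin_ext F (single y q) = qscale q (F y)"
  by (simp add: lin_ext_def)

lemma lin_ext_sum: "lin_ext F (\<Sum>x\<in>A. G x) = (\<Sum>x\<in>A. lin_ext F (G x))"
  by (rule Modules.module_hom.sum[OF lin_ext_linear[unfolded linear_iff_module_hom]])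

lemma lin_ext_lin_ext: "lin_ext F (lin_ext G c) = lin_ext (\<lambda>x. lin_ext F (G x)) c"
  unfolding lin_ext_def[of G] lin_ext_def[of "\<lambda>x. lin_ext F (G x)"]
  by (simp add: lin_ext_sum lin_ext_scale)

lemma lin_ext_push: "lin_ext F (push g c) = lin_ext (\<lambda>x. F (g x)) c"
  unfolding push_conv_lin_ext lin_ext_lin_ext by simp

lemma push_lin_ext:
  fixes c :: "'a \<Rightarrow>\<^sub>0 rat" and F :: "'a \<Rightarrow> ('c \<Rightarrow>\<^sub>0 rat)"
  shows "push g (lin_ext F c) = lin_ext (\<lambda>x. push g (F x)) c"
  unfolding push_conv_lin_ext lin_ext_lin_ext ..

lemma cat_conv_lin_ext: "cat x y = lin_ext (\<lambda>e. lin_ext (\<lambda>f. single (e @ f) 1) y) x"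
  unfolding cat_def lin_ext_def qs.scale_sum_right qs.scale_scale
  by (intro sum.cong refl single_conv)

lemma push_single [simp]: "push g (single x q) = single (g x) (q :: rat)"
  by (simp add: push_def)

lemma relabel_cat: "relabel \<sigma> (cat x y) = cat (relabel \<sigma> x) (relabel \<sigma> y)"
  by (simp add: relabel_def cat_conv_lin_ext push_lin_ext lin_ext_push)

lemma word_sign_map:
  assumes "inj \<sigma>"
  shows "word_sign (map \<sigma> g) (map \<sigma> h) = word_sign g h"
proof -
  have "permute_list p (map \<sigma> g) = map \<sigma> h \<longleftrightarrow> permute_list p g = h"
    if "p permutes {..<length g}" for p
    using that assms by (simp add: permute_list_map inj_map_eq_map)
  hence "(\<lambda>p. p permutes {..<length g} \<and> permute_list p (map \<sigma> g) = map \<sigma> h)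
       = (\<lambda>p. p permutes {..<length g} \<and> permute_list p g = h)" by blast
  thus ?thesis by (simp add: word_sign_def)
qed

lemma relabel_bd_block:
  assumes "inj \<sigma>"
  shows "bd_block (map \<sigma> g) = relabel \<sigma> (bd_block g)"
proof -
  have *: "{A. A \<subset> \<sigma> ` set g \<and> A \<noteq> {}} = (`) \<sigma> ` {A. A \<subset> set g \<and> A \<noteq> {}}"
  proof (intro equalityI subsetI)
    fix A assume A: "A \<in> {A. A \<subset> \<sigma> ` set g \<and> A \<noteq> {}}"
    hence "A = \<sigma> ` (\<sigma> -` A \<inter> set g)" by auto
    moreover from this A have "\<sigma> -` A \<inter> set g \<in> {A. A \<subset> set g \<and> A \<noteq> {}}" by auto
    ultimately show "A \<in> (`) \<sigma> ` {A. A \<subset> set g \<and> A \<noteq> {}}" by blast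
  next
    fix A assume "A \<in> (`) \<sigma> ` {A. A \<subset> set g \<and> A \<noteq> {}}"
    then obtain B where "A = \<sigma> ` B" "B \<subset> set g" "B \<noteq> {}" by auto
    thus "A \<in> {A. A \<subset> \<sigma> ` set g \<and> A \<noteq> {}}"
      using inj_image_eq_iff[OF assms, of B "set g"] by auto
  qed
  have mem: "filter (\<lambda>x. x \<in> \<sigma> ` A) (map \<sigma> g) = map \<sigma> (filter (\<lambda>x. x \<in> A) g)"
    "filter (\<lambda>x. x \<notin> \<sigma> ` A) (map \<sigma> g) = map \<sigma> (filter (\<lambda>x. x \<notin> A) g)" for A
    using assms by (simp_all add: filter_map comp_def inj_image_mem_iff)
  have "inj_on ((`) \<sigma>) {A. A \<subset> set g \<and> A \<noteq> {}}"
    using assms by (auto simp: inj_on_def inj_image_eq_iff)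
  thus ?thesis
    unfolding bd_block_def set_map * relabel_def push_conv_lin_ext lin_ext_sum
    by (subst sum.reindex)
       (simp_all add: Let_def mem word_sign_map[OF assms] flip: map_append single_conv)
qed

lemma relabel_linear: "Vector_Spaces.linear qscale qscale (relabel \<sigma>)"
proof -
  have "relabel \<sigma> = lin_ext (\<lambda>e. single (map (map \<sigma>) e) 1)"
    by (simp add: fun_eq_iff relabel_def push_conv_lin_ext)
  thus ?thesis by (simp only: lin_ext_linear)
qed

lemma relabel_bd_symbol:
  assumes "inj \<sigma>"
  shows "bd_symbol (map (map \<sigma>) e) = relabel \<sigma> (bd_symbol e)"
proof (induction e)
  case Nil
  show ?case by (simp add: relabel_def push_def)
next
  case (Cons g e)
  have s: "relabel \<sigma> (single f 1) = single (map (map \<sigma>) f) 1" for f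
    by (simp add: relabel_def)
  show ?case
    using Cons.IH assms
    by (simp add: relabel_bd_block relabel_cat s
        Modules.module_hom.diff[OF relabel_linear[unfolded linear_iff_module_hom]])
qed

lemma relabel_bd: "inj \<sigma> \<Longrightarrow> relabel \<sigma> (bd c) = bd (relabel \<sigma> c)"
  by (simp add: bd_def relabel_def push_lin_ext lin_ext_push relabel_bd_symbol[unfolded relabel_def])

lemma relabel_bd_all:
  assumes "inj \<sigma>" "c \<in> bd_all"
  shows "relabel \<sigma> c \<in> bd_all"
proof -
  obtain x where x: "c = bd x" "\<forall>e\<in>keys x. is_symbol e \<and> (\<forall>g\<in>set e. length g \<le> 2)"
    using assms by (auto simp: bd_all_def)
  have "is_symbol f \<and> (\<forall>g\<in>set f. length g \<le> 2)" if f: "f \<in> keys (relabel \<sigma> x)" for f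
  proof -
    obtain e where e: "e \<in> keys x" "f = map (map \<sigma>) e"
      using f keys_lin_ext[of f "\<lambda>e. single (map (map \<sigma>) e) 1" x]
      unfolding relabel_def push_conv_lin_ext by auto
    have "distinct (map \<sigma> (concat e))"
      using x e assms by (auto simp: is_symbol_def distinct_map intro: inj_on_subset)
    thus ?thesis using x e by (auto simp: is_symbol_def map_concat)
  qed
  thus ?thesis using x assms by (auto simp: bd_all_def relabel_bd)
qed

lemma hact_cls:
  assumes "inj \<sigma>"
  shows "hact \<sigma> (cls c) = cls (relabel \<sigma> c)"
proof -
  have "homologous (rep_cls (cls c)) c"
    using Quotient3_rel_rep Quotient3_abs_rep Quotient3_hclass hclass.abs_eq_iff by metis
  hence "relabel \<sigma> (rep_cls (cls c) - c) \<in> bd_all"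
    unfolding homologous_def by (rule relabel_bd_all[OF assms])
  thus ?thesis
    by (simp add: hact_def hclass.abs_eq_iff homologous_def
        Modules.module_hom.diff[OF relabel_linear[unfolded linear_iff_module_hom]])
qed


section \<open>The basis of critical symbols\<close>

definition follower :: "symbol \<Rightarrow> nat \<Rightarrow> bool"
  where "follower e j \<longleftrightarrow> 0 < j \<and> (\<exists>a. e ! (j - 1) = [a] \<and> (\<forall>x\<in>set (e ! j). a < x))"

definition critical :: "nat \<Rightarrow> nat \<Rightarrow> symbol \<Rightarrow> bool"
  where "critical n k e \<longleftrightarrow> e \<in> cells2 {1..n} k
    \<and> (\<forall>j a b. Suc j < length e \<and> e ! j = [a] \<and> e ! Suc j = [b] \<longrightarrow> b < a)
    \<and> (\<forall>j c b. j < length e \<and> e ! j = [c, b] \<and> b < c \<longrightarrow> follower e j)"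

fun pieces :: "symbol \<Rightarrow> symbol list"
  where
    "pieces [] = []"
  | "pieces ([a] # [c, b] # e) =
       (if a < b \<and> b < c then [[a], [c, b]] # pieces e else [[a]] # pieces ([c, b] # e))"
  | "pieces (g # e) = [g] # pieces e"

fun z_piece :: "symbol \<Rightarrow> chain"
  where
    "z_piece [[i]] = single [[i]] 1"
  | "z_piece [[a, b]] = single [[a, b]] 1 + single [[b, a]] 1"
  | "z_piece [[a], [c, b]] = relabel (id(1 := a, 2 := b, 3 := c)) (bd_symbol [[3, 2, 1]])"
  | "z_piece _ = 0"

definition z_chain :: "symbol \<Rightarrow> chain"
  where "z_chain e = foldr cat (map z_piece (pieces e)) (single [] 1)"

definition z_cls :: "symbol \<Rightarrow> hclass"
  where "z_cls e = cls (z_chain e)"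

text \<open>The sequence \<open>i\<^sub>1, \<dots>, i\<^sub>n\<close> is given by a permutation \<open>i\<close> of \<open>{1..n}\<close>.\<close>

definition one_block_symbol :: "nat \<Rightarrow> nat \<Rightarrow> (nat \<Rightarrow> nat) \<Rightarrow> symbol"
  where "one_block_symbol n m i =
    map (\<lambda>j. [i j]) [1..<m + 1] @ [[i (m + 1), i (m + 2)]] @ map (\<lambda>j. [i j]) [m + 3..<n + 1]"

definition decreasing_outside :: "nat \<Rightarrow> nat \<Rightarrow> (nat \<Rightarrow> nat) \<Rightarrow> bool"
  where "decreasing_outside n m i \<longleftrightarrow>
    (\<forall>j\<in>{1..<m}. i (j + 1) < i j) \<and> (\<forall>j\<in>{m + 3..<n}. i (j + 1) < i j)"

definition A_set :: "nat \<Rightarrow> nat \<Rightarrow> hclass set"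
  where "A_set n m = {z_cls (one_block_symbol n m i) | i.
    i permutes {1..n} \<and> decreasing_outside n m i \<and> i (m + 1) > i (m + 2) \<and> i (m + 2) > i m}"

definition B_set :: "nat \<Rightarrow> nat \<Rightarrow> hclass set"
  where "B_set n m = {z_cls (one_block_symbol n m i) | i.
    i permutes {1..n} \<and> decreasing_outside n m i \<and> i (m + 2) > i (m + 1)}"


section \<open>High insertion\<close>

definition barrier :: "symbol \<Rightarrow> bool"
  where "barrier p \<longleftrightarrow> (\<exists>g\<in>set p. length g = 2)"

text \<open>\<open>insert_after j x ps\<close> inserts the singleton block \<open>x\<close> after the \<open>j\<close>-th barrier among the pieces
  \<open>ps\<close>; the second equation is reached only if there are fewer than \<open>j\<close> barriers.\<close>

fun insert_after :: "nat \<Rightarrow> nat \<Rightarrow> symbol list \<Rightarrow> symbol list"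
  where
    "insert_after 0 x ps = [[x]] # ps"
  | "insert_after (Suc j) x [] = []"
  | "insert_after (Suc j) x (p # ps) = p # insert_after (if barrier p then j else Suc j) x ps"

definition high_ins :: "nat \<Rightarrow> nat \<Rightarrow> symbol \<Rightarrow> symbol"
  where "high_ins n j e = concat (insert_after j (n + 1) (pieces e))"

text \<open>Only the restriction to \<open>homology {1..n} k\<close>, which is spanned by the \<open>z_cls e\<close>, is relevant and
  determined by the condition.\<close>

definition iota :: "nat \<Rightarrow> nat \<Rightarrow> nat \<Rightarrow> hclass \<Rightarrow> hclass"
  where "iota k n j = (SOME f. Vector_Spaces.linear hscale hscale f \<and>
                          (\<forall>e. critical n k e \<longrightarrow> f (z_cls e) = z_cls (high_ins n j e)))"

text \<open>\<open>iota_iter k j m d\<close> goes from degree \<open>m\<close> to degree \<open>m + d\<close>.\<close>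

primrec iota_iter :: "nat \<Rightarrow> nat \<Rightarrow> nat \<Rightarrow> nat \<Rightarrow> hclass \<Rightarrow> hclass"
  where
    "iota_iter k j m 0 = id"
  | "iota_iter k j m (Suc d) = iota k (m + d) j \<circ> iota_iter k j m d"


section \<open>Representations and FI-modules\<close>

definition linear_betw :: "(rat \<Rightarrow> 'a \<Rightarrow> 'a) \<Rightarrow> 'a set \<Rightarrow> 'a set \<Rightarrow> ('a \<Rightarrow> 'a::ab_group_add) \<Rightarrow> bool"
  where "linear_betw s U W f \<longleftrightarrow> f ` U \<subseteq> W \<and> (\<forall>u\<in>U. \<forall>v\<in>U. f (u + v) = f u + f v)
                                \<and> (\<forall>q. \<forall>u\<in>U. f (s q u) = s q (f u))"

definition sym_rep :: "(rat \<Rightarrow> 'a \<Rightarrow> 'a) \<Rightarrow> nat \<Rightarrow> 'a set \<Rightarrow> ((nat \<Rightarrow> nat) \<Rightarrow> 'a \<Rightarrow> 'a::ab_group_add) \<Rightarrow> bool"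
  where "sym_rep s n U \<rho> \<longleftrightarrow> module.subspace s U
    \<and> (\<forall>\<sigma>. \<sigma> permutes {1..n} \<longrightarrow> linear_betw s U U (\<rho> \<sigma>))
    \<and> (\<forall>u\<in>U. \<rho> id u = u)
    \<and> (\<forall>\<sigma> \<tau>. \<sigma> permutes {1..n} \<longrightarrow> \<tau> permutes {1..n} \<longrightarrow> (\<forall>u\<in>U. \<rho> (\<sigma> \<circ> \<tau>) u = \<rho> \<sigma> (\<rho> \<tau> u)))"

text \<open>\<open>f\<close> induces a linear isomorphism from \<open>P / R\<close> to \<open>W\<close>. (As a linear map on a subspace extends
  to the whole space, it is no restriction that \<open>f\<close> be defined on the whole type.)\<close>

definition quot_iso ::
    "(rat \<Rightarrow> 'a \<Rightarrow> 'a) \<Rightarrow> (rat \<Rightarrow> 'b \<Rightarrow> 'b) \<Rightarrow> 'a set \<Rightarrow> 'a set \<Rightarrow> 'b set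
     \<Rightarrow> ('a::ab_group_add \<Rightarrow> 'b::ab_group_add) \<Rightarrow> bool"
  where "quot_iso s t P R W f \<longleftrightarrow> Vector_Spaces.linear s t f \<and> f ` P = W \<and> {x \<in> P. f x = 0} = R"

text \<open>Morphisms of FI, normalised to be \<open>undefined\<close> outside \<open>[m]\<close>. For \<open>\<sigma>\<close> with
  \<open>\<sigma> permutes {1..m}\<close>, \<open>f \<circ> \<sigma>\<close> is again normalised.\<close>

definition fi_hom :: "nat \<Rightarrow> nat \<Rightarrow> (nat \<Rightarrow> nat) set"
  where "fi_hom m n = {f \<in> {1..m} \<rightarrow>\<^sub>E {1..n}. inj_on f {1..m}}"

text \<open>An FI-module \<open>(V, F)\<close> has the spaces \<open>V n\<close> and, for \<open>f \<in> fi_hom m n\<close>, the induced maps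
  \<open>F m n f\<close>, of which only the restriction to \<open>V m\<close> is relevant.\<close>

definition fi_module ::
    "(rat \<Rightarrow> 'a \<Rightarrow> 'a) \<Rightarrow> (nat \<Rightarrow> 'a set) \<Rightarrow> (nat \<Rightarrow> nat \<Rightarrow> (nat \<Rightarrow> nat) \<Rightarrow> 'a \<Rightarrow> 'a::ab_group_add) \<Rightarrow> bool"
  where "fi_module s V F \<longleftrightarrow>
    (\<forall>n. module.subspace s (V n))
    \<and> (\<forall>m n. \<forall>f\<in>fi_hom m n. linear_betw s (V m) (V n) (F m n f))
    \<and> (\<forall>n. \<forall>v\<in>V n. F n n (restrict id {1..n}) v = v)
    \<and> (\<forall>l m n. \<forall>f\<in>fi_hom l m. \<forall>g\<in>fi_hom m n. \<forall>v\<in>V l.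
         F l n (compose {1..l} g f) v = F m n g (F l m f v))"

text \<open>Degree \<open>n\<close> of \<open>\<Oplus>\<^sub>m \<rat>[Hom([m],\<bullet>)] \<otimes>\<^bsub>\<rat>[S\<^sub>m]\<^esub> U m\<close> is presented as \<open>ind_gens U n / ind_rels s U \<rho> n\<close>.
  The former is \<open>\<Oplus>\<^sub>m \<rat>[Hom([m],[n])] \<otimes>\<^sub>\<rat> U m\<close>, with \<open>single (m, f) u\<close> in the role of \<open>f \<otimes> u\<close>.\<close>

definition ind_gens :: "(nat \<Rightarrow> 'a set) \<Rightarrow> nat \<Rightarrow> (nat \<times> (nat \<Rightarrow> nat) \<Rightarrow>\<^sub>0 'a::ab_group_add) set"
  where "ind_gens U n = {x. \<forall>(m, f)\<in>keys x. f \<in> fi_hom m n \<and> lookup x (m, f) \<in> U m}"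

definition ind_rels ::
    "(rat \<Rightarrow> 'a \<Rightarrow> 'a) \<Rightarrow> (nat \<Rightarrow> 'a set) \<Rightarrow> (nat \<Rightarrow> (nat \<Rightarrow> nat) \<Rightarrow> 'a \<Rightarrow> 'a) \<Rightarrow> nat
     \<Rightarrow> (nat \<times> (nat \<Rightarrow> nat) \<Rightarrow>\<^sub>0 'a::ab_group_add) set"
  where "ind_rels s U \<rho> n = module.span (pm_scale s)
    {single (m, f \<circ> \<sigma>) u - single (m, f) (\<rho> m \<sigma> u) | m f \<sigma> u.
       f \<in> fi_hom m n \<and> \<sigma> permutes {1..m} \<and> u \<in> U m}"

text \<open>The representations \<open>U m\<close> are taken inside the type of the module itself. This is no
  restriction: if \<open>V\<close> is isomorphic to such a direct sum, then \<open>u \<mapsto> id \<otimes> u\<close> embeds \<open>U m\<close> into \<open>V m\<close>.\<close>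

definition free_fi_module ::
    "(rat \<Rightarrow> 'a \<Rightarrow> 'a) \<Rightarrow> (nat \<Rightarrow> 'a set) \<Rightarrow> (nat \<Rightarrow> nat \<Rightarrow> (nat \<Rightarrow> nat) \<Rightarrow> 'a \<Rightarrow> 'a::ab_group_add) \<Rightarrow> bool"
  where "free_fi_module s V F \<longleftrightarrow> fi_module s V F
    \<and> (\<exists>U \<rho> \<phi>. (\<forall>m. sym_rep s m (U m) (\<rho> m))
         \<and> (\<forall>n. quot_iso (pm_scale s) s (ind_gens U n) (ind_rels s U \<rho> n) (V n) (\<phi> n))
         \<and> (\<forall>l m n. \<forall>f\<in>fi_hom l m. \<forall>g\<in>fi_hom m n. \<forall>u\<in>U l.
              \<phi> n (single (l, compose {1..l} g f) u) = F m n g (\<phi> m (single (l, f) u))))"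


section \<open>FI-submodules of the first homology\<close>

definition subrep :: "nat \<Rightarrow> hclass set \<Rightarrow> hclass set \<Rightarrow> bool"
  where "subrep n W V \<longleftrightarrow> hv.subspace W \<and> W \<subseteq> V \<and> (\<forall>\<sigma>. \<sigma> permutes {1..n} \<longrightarrow> hact \<sigma> ` W \<subseteq> W)"

text \<open>An injection \<open>f\<close> factors as the standard inclusion followed by a permutation extending \<open>f\<close>;
  on \<open>H1 m\<close> the result does not depend on the choice of the latter.\<close>

definition H1_map :: "nat \<Rightarrow> nat \<Rightarrow> nat \<Rightarrow> (nat \<Rightarrow> nat) \<Rightarrow> hclass \<Rightarrow> hclass"
  where "H1_map j m n f =
    hact (SOME \<sigma>. \<sigma> permutes {1..n} \<and> (\<forall>i\<in>{1..m}. \<sigma> i = f i)) \<circ> iota_iter 1 j m (n - m)"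

definition H1_submodule :: "nat \<Rightarrow> (nat \<Rightarrow> hclass set) \<Rightarrow> bool"
  where "H1_submodule j W \<longleftrightarrow> (\<forall>n. subrep n (W n) (H1 n)) \<and> (\<forall>n. iota 1 n j ` W n \<subseteq> W (Suc n))"

text \<open>The submodule generated by \<open>V \<subseteq> H1 d\<close> and \<open>[\<iota>\<^sub>j]\<close>.\<close>

definition H1_generated :: "nat \<Rightarrow> nat \<Rightarrow> hclass set \<Rightarrow> nat \<Rightarrow> hclass set"
  where "H1_generated j d V n = \<Inter> {W n | W. H1_submodule j W \<and> V \<subseteq> W d}"


section \<open>The exterior square of the standard representation\<close>

definition Std :: "nat \<Rightarrow> (nat \<Rightarrow>\<^sub>0 rat) set"
  where "Std N = {v. keys v \<subseteq> {1..N} \<and> (\<Sum>i\<in>{1..N}. lookup v i) = 0}"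

text \<open>\<open>Std N \<otimes> Std N\<close> is regarded as a subspace of \<open>\<rat>\<^sup>N \<otimes> \<rat>\<^sup>N = \<rat>\<^bsup>N\<times>N\<^esup>\<close>.\<close>

definition tensor :: "(nat \<Rightarrow>\<^sub>0 rat) \<Rightarrow> (nat \<Rightarrow>\<^sub>0 rat) \<Rightarrow> (nat \<times> nat \<Rightarrow>\<^sub>0 rat)"
  where "tensor v w = (\<Sum>i\<in>keys v. \<Sum>j\<in>keys w. single (i, j) (lookup v i * lookup w j))"

definition iso_ext2_Std :: "nat \<Rightarrow> hclass set \<Rightarrow> bool"
  where "iso_ext2_Std N W \<longleftrightarrow> subrep N W (H1 N) \<and>
    (\<exists>\<phi>. let T = module.span qscale {tensor v w | v w. v \<in> Std N \<and> w \<in> Std N};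
             R = module.span qscale {tensor v v | v. v \<in> Std N}
         in quot_iso qscale hscale T R W \<phi>
            \<and> (\<forall>\<sigma>. \<sigma> permutes {1..N} \<longrightarrow>
                 (\<forall>x\<in>T. \<phi> (push (map_prod \<sigma> \<sigma>) x) = hact \<sigma> (\<phi> x))))"


section \<open>Admissible families\<close>

definition admissible :: "(nat \<Rightarrow> nat \<Rightarrow> hclass set) \<Rightarrow> bool"
  where "admissible A' \<longleftrightarrow> (\<forall>n m. 3 \<le> n \<longrightarrow> 1 \<le> m \<longrightarrow> m \<le> n - 2 \<longrightarrow>
      finite (A' n m) \<and> A' n m \<subseteq> H1 n
    \<and> hv.independent (A' n m) \<and> card (A' n m) = card (A_set n m)
    \<and> hv.span (B_set n 0 \<union> (\<Union>l\<in>{1..m}. A' n l \<union> B_set n l))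
        = hv.span (B_set n 0 \<union> (\<Union>l\<in>{1..m}. A_set n l \<union> B_set n l))
    \<and> (let W = H1_generated 1 (m + 2) (hv.span (A' (m + 2) m))
       in hv.span (A' n m) = W n \<and> free_fi_module hscale W (H1_map 1))
    \<and> iso_ext2_Std (m + 2) (hv.span (A' (m + 2) m))
    \<and> subrep (m + 2) (hv.span (A' (m + 2) m)) (H1_generated 0 3 (hv.span (A' 3 1)) (m + 2)))"

end

theory Submission
  imports Defs
begin

text \<open>
  The content of the statement is Alpert's basis theorem in degree one: the classes \<open>z_cls e\<close>, for the
  critical symbols \<open>e\<close> with one two-element block, form a basis of \<open>H1 n\<close>. Given that theorem, the
  union of the \<open>A' n m\<close> and \<open>B_set n m\<close> spans \<open>H1 n\<close>, because by admissibility (with \<open>m = n - 2\<close>) it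
  has the same span as the union of the \<open>A_set n m\<close> and \<open>B_set n m\<close>; and it has at most as many elements
  as that basis, because \<open>card (A' n m) = card (A_set n m)\<close>. A spanning set with no more elements
  than a basis is independent.

  One-dimensional cells are edges \<open>p|x y|s\<close> between the permutations \<open>p|x|y|s\<close> and \<open>p|y|x|s\<close>, and
  two-dimensional cells with blocks of size at most two are squares, which express that two disjoint
  adjacent swaps commute. Up to sign, the cycles \<open>z_chain e\<close> are the digons, formed by the two
  edges \<open>p|a b|s\<close> and \<open>p|b a|s\<close>, and the hexagons, which form the boundary of a block of three labels
  \<open>a < b < c\<close> between \<open>p\<close> and \<open>s\<close>; in both cases \<open>p\<close> and \<open>s\<close> are decreasing, and for a hexagon \<open>a\<close> is less
  than every label of \<open>p\<close>.

  They span (\<open>homology_subset_loop_span\<close>, \<open>loop_span_subset_span\<close>): insertion sort gives a path from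
  each permutation to the decreasing one, and every edge, together with the sorting paths of its
  ends, closes up to a loop. Modulo squares this loop is a sum of digons and hexagons
  (\<open>sort_path_edge\<close>). So every cycle is, modulo digons and hexagons, equal to the sum of the sorting
  paths over its boundary, which vanishes. Inserting from the right into a decreasing word makes only those hexagons
  appear that belong to the basis, up to the order of the word after them. Squares serve to rearrange
  this word and the words on both sides of a digon.

  They are independent (\<open>independent_z_cls\<close>): any function of the edge \<open>p|x y|s\<close> that depends only on
  \<open>set p\<close>, \<open>x\<close> and \<open>y\<close> is a cocycle up to a sign, since the two parallel edges of a square agree in these data
  (\<open>pairing_boundary\<close>). Among these functions there is a dual system for the digons and hexagons
  (\<open>dual_weight\<close>).
\<close>


section \<open>Edges and squares\<close>

definition vertex :: "nat list \<Rightarrow> symbol"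
  where "vertex p = map (\<lambda>x. [x]) p"

text \<open>The sign makes the boundary of an edge the difference of its two ends, independently of the length
  of \<open>p\<close>, see \<open>bd_edge\<close>.\<close>

definition edge :: "nat list \<Rightarrow> nat \<Rightarrow> nat \<Rightarrow> nat list \<Rightarrow> chain"
  where "edge p x y s = single (vertex p @ [x, y] # vertex s) ((-1) ^ length p)"

lemma vertex_simps [simp]:
  "vertex [] = []" "vertex (x # p) = [x] # vertex p" "vertex (p @ q) = vertex p @ vertex q"
  "concat (vertex p) = p" "length (vertex p) = length p" "[] \<notin> set (vertex p)"
  by (auto simp: vertex_def)

lemma vertex_blocks: "g \<in> set (vertex p) \<Longrightarrow> length g = 1"
  by (auto simp: vertex_def)

lemma cat_single_single [simp]: "cat (single e q) (single f r) = single (e @ f) (q * r)"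
  by (cases "q = 0"; cases "r = 0") (simp_all add: cat_def)

lemma cat_zero [simp]: "cat 0 y = 0" "cat x 0 = 0"
  by (simp_all add: cat_def)

lemma cat_add_left: "cat (x + x') y = cat x y + cat x' y"
  by (simp add: cat_conv_lin_ext lin_ext_add)

lemma cat_single_left: "cat (single e 1) y = push ((@) e) y"
  by (simp add: cat_conv_lin_ext push_conv_lin_ext)

lemma append_Cons_fun: "(@) (g # e) = (\<lambda>f. g # e @ f)"
  by auto

lemma push_add:
  fixes c :: "'a \<Rightarrow>\<^sub>0 rat" shows "push f (c + d) = push f c + push f d"
  by (simp add: push_conv_lin_ext lin_ext_add)

lemma push_uminus:
  fixes c :: "'a \<Rightarrow>\<^sub>0 rat" shows "push f (- c) = - push f c"
  using push_add[of f c "- c"] by (simp add: push_def add_eq_0_iff)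

lemma push_diff:
  fixes c :: "'a \<Rightarrow>\<^sub>0 rat" shows "push f (c - d) = push f c - push f d"
  using push_add[of f c "- d"] by (simp add: push_uminus)

lemma push_scale:
  fixes c :: "'a \<Rightarrow>\<^sub>0 rat" shows "push f (qscale q c) = qscale q (push f c)"
  by (simp add: push_conv_lin_ext lin_ext_scale)

lemma push_id:
  fixes c :: "'a \<Rightarrow>\<^sub>0 rat" shows "push (\<lambda>x. x) c = c"
  unfolding push_def
  by (rule poly_mapping_eqI) (auto simp: lookup_sum lookup_single when_def in_keys_iff)

lemma cat_diff_left: "cat (x - x') y = cat x y - cat x' y"
proof -
  have "cat (x - x') y + cat x' y = cat x y" by (simp flip: cat_add_left)
  thus ?thesis by (simp add: algebra_simps)
qed

lemma qscale_single [simp]: "qscale q (single e r) = single e (q * r)"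
  by (rule poly_mapping_eqI) (simp add: lookup_single when_def)

lemma word_signI:
  assumes "distinct g" "p permutes {..<length g}" "permute_list p g = h"
  shows "word_sign g h = of_int (sign p)"
proof -
  have "q = p" if q: "q permutes {..<length g}" "permute_list q g = h" for q
  proof
    fix i show "q i = p i"
    proof (cases "i < length g")
      case True
      hence "g ! q i = g ! p i"
        using permute_list_nth[OF q(1) True] permute_list_nth[OF assms(2) True] q(2) assms(3) by simp
      moreover have "q i < length g" "p i < length g"
        using True permutes_in_image[OF q(1), of i] permutes_in_image[OF assms(2), of i] by auto
      ultimately show ?thesis using nth_eq_iff_index_eq[OF assms(1)] by simp
    next
      case False
      thus ?thesis using permutes_not_in[OF q(1)] permutes_not_in[OF assms(2)] by simp
    qed
  qed
  with assms(2,3) have "(THE p. p permutes {..<length g} \<and> permute_list p g = h) = p"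
    by (intro the_equality conjI) blast+
  thus ?thesis by (simp add: word_sign_def)
qed

lemma bd_block_singleton: "bd_block [x] = 0"
proof -
  have "{A. A \<subset> set [x] \<and> A \<noteq> {}} = {}" by auto
  thus ?thesis unfolding bd_block_def by (simp only: sum.empty)
qed

lemma sum_Pow_insert:
  assumes "finite S" "a \<notin> S"
  shows "(\<Sum>A\<in>Pow (insert a S). f A) = (\<Sum>A\<in>Pow S. f A) + (\<Sum>A\<in>Pow S. f (insert a A))"
proof -
  have "inj_on (insert a) (Pow S)"
    using assms(2) by (intro inj_onI) (metis PowD insert_ident subsetD)
  moreover have "Pow S \<inter> insert a ` Pow S = {}"
    using assms(2) by blast
  ultimately show ?thesis
    using assms(1) by (simp add: Pow_insert sum.union_disjoint sum.reindex)
qed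

lemma sum_proper_subsets:
  fixes f :: "'a set \<Rightarrow> 'b :: ab_group_add"
  assumes "finite S" "S \<noteq> {}"
  shows "(\<Sum>A | A \<subset> S \<and> A \<noteq> {}. f A) = (\<Sum>A\<in>Pow S. f A) - f S - f {}"
proof -
  define X where "X = {A. A \<subset> S \<and> A \<noteq> {}}"
  have X: "finite X" "S \<notin> insert {} X" "{} \<notin> X"
    using assms by (auto simp: X_def intro: finite_subset[of _ "Pow S"])
  have "Pow S = insert S (insert {} X)" by (auto simp: X_def)
  thus ?thesis unfolding X_def[symmetric] using X by simp
qed

lemma bd_block_pair:
  assumes "x \<noteq> y"
  shows "bd_block [x, y] = single [[x], [y]] 1 - single [[y], [x]] 1"
proof -
  have 1: "word_sign [x, y] [x, y] = 1"
    using assms by (subst word_signI[of _ id]) (auto simp: permutes_id sign_id)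
  have 2: "word_sign [x, y] [y, x] = -1"
    using assms
    by (subst word_signI[of _ "transpose 0 1"])
       (auto simp: permutes_swap_id sign_swap_id permute_list_def)
  show ?thesis
    unfolding bd_block_def using assms
    by (subst sum_proper_subsets) (simp_all add: sum_Pow_insert Let_def 1 2 single_uminus)
qed

lemma bd_block_321:
  "bd_block [3, 2, 1] = single [[3], [2, 1]] 1 - single [[2], [3, 1]] 1 + single [[1], [3, 2]] 1
     + single [[3, 2], [1]] 1 - single [[3, 1], [2]] 1 + single [[2, 1], [3]] 1"
proof -
  have perm: "transpose i j permutes {..<Suc (Suc (Suc 0))}" if "i < 3" "j < 3" for i j
    using that by (intro permutes_swap_id) auto
  have perm2: "transpose i j \<circ> transpose k l permutes {..<Suc (Suc (Suc 0))}"
    if "i < 3" "j < 3" "k < 3" "l < 3" for i j k l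
    using that perm by (intro permutes_compose) auto
  have perm3: "permute_list p [3, 2, Suc 0] = [[3, 2, 1] ! p 0, [3, 2, 1] ! p 1, [3, 2, 1] ! p 2]" for p
    by (simp add: permute_list_def upt_rec numeral_2_eq_2)
  have sgn: "sign (transpose 0 (Suc 0) \<circ> transpose (Suc 0) 2) = 1"
    "sign (transpose (Suc 0) 2 \<circ> transpose 0 (Suc 0)) = 1"
    by (simp_all only: sign_compose[OF permutation_swap_id permutation_swap_id]) (simp_all add: sign_swap_id)
  have 1: "word_sign [3, 2, 1] [3, 2, 1] = 1"
    by (subst word_signI[of _ id]) (simp_all add: permutes_id)
  have 2: "word_sign [3, 2, 1] [2, 3, 1] = -1"
    by (subst word_signI[of _ "transpose 0 1"])
       (simp_all add: sign_swap_id perm perm3 transpose_def)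
  have 3: "word_sign [3, 2, 1] [3, 1, 2] = -1"
    by (subst word_signI[of _ "transpose 1 2"])
       (simp_all add: sign_swap_id perm perm3 transpose_def)
  have 4: "word_sign [3, 2, 1] [2, 1, 3] = 1"
    by (subst word_signI[of _ "transpose 0 1 \<circ> transpose 1 2"];
        (simp add: sgn perm2; fail | simp add: perm3 transpose_def))
  have 5: "word_sign [3, 2, 1] [1, 3, 2] = 1"
    by (subst word_signI[of _ "transpose 1 2 \<circ> transpose 0 1"];
        (simp add: sgn perm2; fail | simp add: perm3 transpose_def))
  note signs = 1 2 3 4 5
  show ?thesis
    unfolding bd_block_def
    by (subst sum_proper_subsets)
       (simp_all add: sum_Pow_insert Let_def signs[unfolded One_nat_def] single_uminus algebra_simps)
qed

lemma bd_symbol_vertex_append: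
  "bd_symbol (vertex p @ e) = qscale ((-1) ^ length p) (push ((@) (vertex p)) (bd_symbol e))"
proof (induction p)
  case Nil
  show ?case by (simp add: push_id)
next
  case (Cons x p)
  have "push ((@) [[x]]) (push ((@) (vertex p)) c) = push ((@) (vertex (x # p))) c" for c :: chain
    by (simp add: push_conv_lin_ext lin_ext_lin_ext)
  thus ?case using Cons
    by (simp add: bd_block_singleton cat_single_left append_Cons_fun push_scale)
qed

lemma bd_symbol_vertex: "bd_symbol (vertex p) = 0"
  using bd_symbol_vertex_append[of p "[]"] by (simp add: push_def)

lemma bd_symbol_pair:
  assumes "x \<noteq> y"
  shows "bd_symbol ([x, y] # e) = single ([x] # [y] # e) 1 - single ([y] # [x] # e) 1
           - push ((#) [x, y]) (bd_symbol e)"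
  using assms by (simp add: bd_block_pair cat_diff_left cat_single_left append_Cons_fun)

lemma bd_single: "bd (single e q) = qscale q (bd_symbol e)"
  by (simp add: bd_def)

lemma bd_edge:
  assumes "x \<noteq> y"
  shows "bd (edge p x y s) = single (vertex (p @ x # y # s)) 1 - single (vertex (p @ y # x # s)) 1"
proof -
  have "(-1) ^ k * (-1) ^ k = (1::rat)" for k :: nat
    by (simp flip: power_mult_distrib)
  moreover have "push f 0 = (0 :: chain)" for f :: "symbol \<Rightarrow> symbol"
    by (simp add: push_def)
  ultimately show ?thesis
    using assms unfolding edge_def bd_single bd_symbol_vertex_append
    by (simp add: bd_symbol_pair bd_symbol_vertex push_diff qs.scale_right_diff_distrib del: bd_symbol.simps)
qed

text \<open>A square has two edges for the swap of \<open>z\<close> and \<open>w\<close>, taken before and after the swap of \<open>x\<close> and \<open>y\<close>,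
  and two for the swap of \<open>x\<close> and \<open>y\<close>.\<close>

lemma bd_square:
  assumes "x \<noteq> y" "z \<noteq> w"
  shows "bd (single (vertex p @ [x, y] # vertex q @ [z, w] # vertex s) ((-1) ^ length q))
    = edge (p @ x # y # q) z w s - edge (p @ y # x # q) z w s
      - edge p x y (q @ z # w # s) + edge p x y (q @ w # z # s)"
proof -
  have sq: "(-1) ^ k * (-1) ^ k = (1::rat)" for k :: nat
    by (simp flip: power_mult_distrib)
  have sq': "(-1) ^ k * ((-1) ^ k * r) = (r::rat)" for k :: nat and r
    by (simp add: sq flip: mult.assoc)
  have 0: "push f 0 = (0 :: chain)" for f :: "symbol \<Rightarrow> symbol"
    by (simp add: push_def)
  show ?thesis
    using assms unfolding edge_def bd_single bd_symbol_vertex_append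
    by (simp add: bd_symbol_pair bd_symbol_vertex bd_symbol_vertex_append push_diff push_scale 0
        qs.scale_right_diff_distrib power_add sq sq' mult.commute mult.left_commute del: bd_symbol.simps)
qed

lemma cls_add: "cls (c + d) = cls c + cls d"
  by (simp add: plus_hclass.abs_eq)

lemma cls_diff: "cls (c - d) = cls c - cls d"
  by (simp add: minus_hclass.abs_eq)

lemma cls_zero: "cls 0 = 0"
  by (simp add: zero_hclass_def)

lemma cls_scale: "cls (qscale q c) = hscale q (cls c)"
  by (simp add: hscale.abs_eq)

lemma cls_sum: "cls (\<Sum>x\<in>A. f x) = (\<Sum>x\<in>A. cls (f x))"
  by (induction A rule: infinite_finite_induct) (simp_all add: cls_zero cls_add)

lemma cls_eq_0I: "c \<in> bd_all \<Longrightarrow> cls c = 0"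
  by (simp add: zero_hclass_def hclass.abs_eq_iff homologous_def)

text \<open>In homology, disjoint swaps commute. This is the only relation between edges that is used below.\<close>

lemma square_relation:
  assumes "distinct (p @ x # y # q @ z # w # s)"
  shows "cls (edge (p @ x # y # q) z w s) - cls (edge (p @ y # x # q) z w s)
       = cls (edge p x y (q @ z # w # s)) - cls (edge p x y (q @ w # z # s))"
proof -
  let ?e = "vertex p @ [x, y] # vertex q @ [z, w] # vertex s"
  let ?c = "single ?e ((-1) ^ length q) :: chain"
  have e: "is_symbol ?e \<and> (\<forall>g\<in>set ?e. length g \<le> 2)"
    using assms by (auto simp: is_symbol_def dest: vertex_blocks)
  have "bd ?c \<in> bd_all"
    unfolding bd_all_def by (rule imageI) (use e in simp)
  hence "cls (bd ?c) = 0" by (rule cls_eq_0I)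
  thus ?thesis using assms
    by (subst (asm) bd_square) (simp_all add: cls_add cls_diff algebra_simps)
qed


section \<open>Sorting paths\<close>

text \<open>The path followed by \<open>x\<close> when it moves left from \<open>rev r|x|s\<close> to its place in the word \<open>rev r\<close>. The first
  argument is the decreasing word read backwards, so that the recursion is that of \<open>insort\<close>.\<close>

primrec insert_path :: "nat list \<Rightarrow> nat \<Rightarrow> nat list \<Rightarrow> chain"
  where
    "insert_path [] x s = 0"
  | "insert_path (z # r) x s = (if x \<le> z then 0 else edge (rev r) z x s + insert_path r x (z # s))"

text \<open>The concatenation of the insertion paths of insertion sort, from \<open>rev r|s\<close> to \<open>rev (sort r)|s\<close>.\<close>

primrec sort_path :: "nat list \<Rightarrow> nat list \<Rightarrow> chain"
  where
    "sort_path [] s = 0"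
  | "sort_path (x # r) s = sort_path r (x # s) + insert_path (sort r) x s"

text \<open>While \<open>x\<close> moves to its place, each of its steps spans a square with the swap of \<open>a\<close> and \<open>b\<close> further to the
  right; these squares form a strip between the two insertion paths.\<close>

lemma insert_path_swap:
  assumes "distinct (rd @ x # q @ a # b # s)"
  shows "cls (insert_path rd x (q @ a # b # s)) - cls (insert_path rd x (q @ b # a # s))
       = cls (edge (rev rd @ x # q) a b s) - cls (edge (rev (insort x rd) @ q) a b s)"
  using assms
proof (induction rd arbitrary: q)
  case (Cons z r)
  have "distinct (rev r @ z # x # q @ a # b # s)" using Cons.prems by auto
  note square_relation[OF this]
  moreover have "distinct (r @ x # (z # q) @ a # b # s)" using Cons.prems by auto
  note Cons.IH[OF this]
  ultimately show ?case by (simp add: cls_add algebra_simps)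
qed simp

lemma sort_path_swap:
  assumes "distinct (r @ q @ a # b # s)"
  shows "cls (sort_path r (q @ a # b # s)) - cls (sort_path r (q @ b # a # s))
       = cls (edge (rev r @ q) a b s) - cls (edge (rev (sort r) @ q) a b s)"
  using assms
proof (induction r arbitrary: q)
  case (Cons x r)
  have "distinct (r @ (x # q) @ a # b # s)" using Cons.prems by auto
  note Cons.IH[OF this]
  moreover have "distinct (sort r @ x # q @ a # b # s)" using Cons.prems by auto
  note insert_path_swap[OF this]
  ultimately show ?case by (simp add: cls_add algebra_simps)
qed simp


section \<open>Digons and hexagons\<close>

definition digon :: "nat list \<Rightarrow> nat \<Rightarrow> nat \<Rightarrow> nat list \<Rightarrow> chain"
  where "digon p a b s = edge p a b s + edge p b a s"

definition hexagon :: "nat list \<Rightarrow> nat \<Rightarrow> nat \<Rightarrow> nat \<Rightarrow> nat list \<Rightarrow> chain"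
  where "hexagon p a b c s =
    edge p b a (c # s) - edge (p @ [c]) b a s
    - (edge p c a (b # s) - edge (p @ [b]) c a s)
    + (edge p c b (a # s) - edge (p @ [a]) c b s)"

text \<open>Hexagons are restricted to those that belong to the basis, except that the order of \<open>s\<close> is arbitrary.\<close>

definition loop_span :: "nat set \<Rightarrow> hclass set"
  where "loop_span S = hv.span
    ({cls (digon p a b s) | p a b s. distinct (p @ a # b # s) \<and> set (p @ a # b # s) = S}
     \<union> {cls (hexagon p a b c s) | p a b c s. distinct (p @ a # b # c # s) \<and> set (p @ a # b # c # s) = S
          \<and> sorted_wrt (>) (p @ [a]) \<and> a < b \<and> b < c})"

lemma digon_in_loop_span:
  "distinct (p @ a # b # s) \<Longrightarrow> set (p @ a # b # s) = S \<Longrightarrow> cls (digon p a b s) \<in> loop_span S"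
  unfolding loop_span_def by (rule hv.span_base) blast

lemma hexagon_in_loop_span:
  "distinct (p @ a # b # c # s) \<Longrightarrow> set (p @ a # b # c # s) = S \<Longrightarrow> sorted_wrt (>) (p @ [a]) \<Longrightarrow>
   a < b \<Longrightarrow> b < c \<Longrightarrow> cls (hexagon p a b c s) \<in> loop_span S"
  unfolding loop_span_def by (rule hv.span_base) blast

lemma loop_span_subspace: "hv.subspace (loop_span S)"
  unfolding loop_span_def by (rule hv.subspace_span)

lemmas loop_span_add = hv.subspace_add[OF loop_span_subspace]
lemmas loop_span_diff = hv.subspace_diff[OF loop_span_subspace]

text \<open>The edge swapping \<open>x\<close> and \<open>y\<close>, closed up by inserting \<open>x\<close> and \<open>y\<close> in both orders. Let \<open>z\<close> be the
  last and least label of the word that they are inserted into. If \<open>x < z\<close>, then \<open>x\<close> stays, and the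
  insertion of \<open>y\<close> from the right of \<open>x\<close> is the edge itself, followed by the insertion of \<open>y\<close> from the left
  of \<open>x\<close>. Otherwise both pass \<open>z\<close>: the two ways of doing so, the edge before and the edge after form a
  hexagon on \<open>z < x < y\<close>, the order of the passages being adjusted by squares (\<open>insert_path_swap\<close>) and the
  orientation of edges by digons. The induction continues with the edge to the left of \<open>z\<close>. As \<open>z\<close> ends a
  decreasing word, the hexagon is one of those in \<open>loop_span\<close>.\<close>

lemma insert_two_less:
  assumes "sorted rd" "distinct (rd @ x # y # s)" "set (rd @ x # y # s) = S" "x < y"
  shows "cls (edge (rev rd) x y s)
      - (cls (insert_path rd x (y # s)) + cls (insert_path (insort x rd) y s)
         - cls (insert_path rd y (x # s)) - cls (insert_path (insort y rd) x s)) \<in> loop_span S"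
  using assms
proof (induction rd arbitrary: s)
  case Nil
  thus ?case by (simp add: cls_zero hv.subspace_0[OF loop_span_subspace])
next
  case (Cons z r)
  show ?case
  proof (cases "x < z")
    case True
    thus ?thesis using Cons.prems
      by (simp add: cls_zero cls_add hv.subspace_0[OF loop_span_subspace])
  next
    case False
    hence z: "z < x" "z < y" using Cons.prems by auto
    let ?r = "rev r"
    have d: "distinct (?r @ z # x # y # s)" "set (?r @ z # x # y # s) = S" using Cons.prems by auto
    have "sorted_wrt (<) (z # r)"
      using Cons.prems by (simp add: strict_sorted_iff del: sorted_wrt.simps)
    hence "sorted_wrt (>) (?r @ [z])"
      by (simp add: sorted_wrt_append sorted_wrt_rev)
    hence hex: "cls (hexagon ?r z x y s) \<in> loop_span S"
      using d z Cons.prems(4) by (intro hexagon_in_loop_span)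
    have dig: "cls (digon (?r @ [z]) x y s) \<in> loop_span S" "cls (digon ?r z x (y # s)) \<in> loop_span S"
      "cls (digon ?r z y (x # s)) \<in> loop_span S" "cls (digon (?r @ [x]) z y s) \<in> loop_span S"
      "cls (digon (?r @ [y]) z x s) \<in> loop_span S" "cls (digon ?r x y (z # s)) \<in> loop_span S"
      using d by (auto intro!: digon_in_loop_span)
    have IH: "cls (edge ?r x y (z # s))
      - (cls (insert_path r x (y # z # s)) + cls (insert_path (insort x r) y (z # s))
         - cls (insert_path r y (x # z # s)) - cls (insert_path (insort y r) x (z # s))) \<in> loop_span S"
      using Cons.prems by (intro Cons.IH) auto
    have 1: "cls (insert_path r x (z # y # s)) = cls (insert_path r x (y # z # s))
           + cls (edge (?r @ [x]) z y s) - cls (edge (rev (insort x r)) z y s)"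
      using insert_path_swap[of r x "[]" z y s] Cons.prems by (auto simp: algebra_simps)
    have 2: "cls (insert_path r y (z # x # s)) = cls (insert_path r y (x # z # s))
           + cls (edge (?r @ [y]) z x s) - cls (edge (rev (insort y r)) z x s)"
      using insert_path_swap[of r y "[]" z x s] Cons.prems by (auto simp: algebra_simps)
    \<comment> \<open>The digons turn the edges of the insertion paths into the decreasing edges of the hexagon.\<close>
    note mem = loop_span_add[OF IH loop_span_add[OF hex loop_span_diff[OF
      loop_span_add[OF loop_span_add[OF dig(1) dig(3)] dig(5)]
      loop_span_add[OF loop_span_add[OF dig(2) dig(4)] dig(6)]]]]
    show ?thesis
      using mem z
      by (simp add: hexagon_def digon_def cls_add cls_diff 1 2 algebra_simps)
  qed
qed

lemma insert_two:
  assumes "sorted rd" "distinct (rd @ x # y # s)" "set (rd @ x # y # s) = S"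
  shows "cls (edge (rev rd) x y s)
      - (cls (insert_path rd x (y # s)) + cls (insert_path (insort x rd) y s)
         - cls (insert_path rd y (x # s)) - cls (insert_path (insort y rd) x s)) \<in> loop_span S"
proof (cases "x < y")
  case True
  thus ?thesis using assms by (intro insert_two_less)
next
  case False
  hence "y < x" using assms by auto
  hence 1: "cls (edge (rev rd) y x s)
      - (cls (insert_path rd y (x # s)) + cls (insert_path (insort y rd) x s)
         - cls (insert_path rd x (y # s)) - cls (insert_path (insort x rd) y s)) \<in> loop_span S"
    using assms by (intro insert_two_less) auto
  have 2: "cls (digon (rev rd) x y s) \<in> loop_span S"
    using assms by (intro digon_in_loop_span) auto
  show ?thesis using loop_span_diff[OF 2 1] by (simp add: digon_def cls_add algebra_simps)
qed

text \<open>The sorting paths of the two ends of an edge \<open>x y\<close> run in parallel until \<open>x\<close> and \<open>y\<close> are to be inserted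
  (\<open>sort_path_swap\<close>), then close up by \<open>insert_two\<close>, and agree afterwards.\<close>

lemma sort_path_edge:
  assumes "distinct (u @ y # x # r @ s)" "set (u @ y # x # r @ s) = S"
  shows "cls (edge (rev r) x y (rev u @ s))
      - (cls (sort_path (u @ y # x # r) s) - cls (sort_path (u @ x # y # r) s)) \<in> loop_span S"
  using assms
proof (induction u arbitrary: s)
  case Nil
  have ins: "cls (edge (rev (sort r)) x y s)
      - (cls (insert_path (sort r) x (y # s)) + cls (insert_path (insort x (sort r)) y s)
         - cls (insert_path (sort r) y (x # s)) - cls (insert_path (insort y (sort r)) x s)) \<in> loop_span S"
    using Nil by (intro insert_two) auto
  have swap: "cls (sort_path r (x # y # s)) = cls (sort_path r (y # x # s))
       + cls (edge (rev r) x y s) - cls (edge (rev (sort r)) x y s)"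
    using sort_path_swap[of r "[]" x y s] Nil by (auto simp: algebra_simps)
  show ?case using ins by (simp add: cls_add swap algebra_simps)
next
  case (Cons a u)
  have "sort (u @ y # x # r) = sort (u @ x # y # r)"
    by (rule properties_for_sort) simp_all
  moreover have "cls (edge (rev r) x y (rev u @ a # s))
      - (cls (sort_path (u @ y # x # r) (a # s)) - cls (sort_path (u @ x # y # r) (a # s))) \<in> loop_span S"
    using Cons.prems by (intro Cons.IH) auto
  ultimately show ?case by (simp add: cls_add)
qed


section \<open>Digons and hexagons span the first homology\<close>

lemma blocks_of_length_one:
  "\<forall>g\<in>set e. length g = 1 \<or> length g = 2 \<Longrightarrow> length (concat e) = length e \<Longrightarrow> e = vertex (concat e)"
proof (induction e)
  case (Cons g e)
  have "length e \<le> length (concat e)" using Cons.prems(1)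
    by (induction e) (auto simp: numeral_2_eq_2)
  with Cons.prems have "length g = 1" "length (concat e) = length e" by auto
  thus ?case using Cons by (auto simp: length_Suc_conv)
qed simp

lemma first_pair_block:
  "\<forall>g\<in>set e. length g = 1 \<or> length g = 2 \<Longrightarrow> length (concat e) = length e + Suc k \<Longrightarrow>
   \<exists>p x y f. e = vertex p @ [x, y] # f \<and> length (concat f) = length f + k"
proof (induction e)
  case (Cons g e)
  from Cons.prems(1) consider (1) x where "g = [x]" | (2) x y where "g = [x, y]"
    by (auto simp: length_Suc_conv numeral_2_eq_2)
  thus ?case
  proof cases
    case 1
    with Cons obtain p a b f where "e = vertex p @ [a, b] # f" "length (concat f) = length f + k"
      by fastforce
    with 1 have "g # e = vertex (x # p) @ [a, b] # f" by simp
    thus ?thesis using \<open>length (concat f) = length f + k\<close> by blast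
  next
    case 2
    hence "g # e = vertex [] @ [x, y] # e" "length (concat e) = length e + k"
      using Cons.prems(2) by auto
    thus ?thesis by blast
  qed
qed simp

lemma cells2_blocks:
  assumes "e \<in> cells2 S k"
  shows "\<forall>g\<in>set e. length g = 1 \<or> length g = 2" "length (concat e) = length e + k"
    "distinct (concat e)" "set (concat e) = S"
proof -
  show "distinct (concat e)" "set (concat e) = S"
    using assms by (auto simp: cells2_def is_symbol_def)
  thus "length (concat e) = length e + k"
    using assms distinct_card[of "concat e"] by (simp add: cells2_def)
  show "\<forall>g\<in>set e. length g = 1 \<or> length g = 2"
  proof
    fix g assume "g \<in> set e"
    hence "g \<noteq> []" "length g \<le> 2" using assms by (auto simp: cells2_def is_symbol_def)
    thus "length g = 1 \<or> length g = 2" by (cases g; cases "tl g") auto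
  qed
qed

lemma cells2_1_cases:
  assumes "e \<in> cells2 S 1"
  obtains p x y s where "e = vertex p @ [x, y] # vertex s"
    "distinct (p @ x # y # s)" "set (p @ x # y # s) = S"
proof -
  note e = cells2_blocks[OF assms]
  from first_pair_block[of e 0] e(1,2) obtain p x y f
    where 1: "e = vertex p @ [x, y] # f" "length (concat f) = length f" by auto
  moreover have "f = vertex (concat f)"
    using 1 e(1) by (intro blocks_of_length_one) auto
  ultimately obtain s where "e = vertex p @ [x, y] # vertex s" by metis
  thus ?thesis using e(3,4) by (intro that) auto
qed

lemma cells2_2_cases:
  assumes "e \<in> cells2 S 2"
  obtains p x y q z w s where "e = vertex p @ [x, y] # vertex q @ [z, w] # vertex s"
    "distinct (p @ x # y # q @ z # w # s)"
proof -
  note e = cells2_blocks[OF assms]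
  from first_pair_block[of e 1] e(1,2) obtain p x y f
    where 1: "e = vertex p @ [x, y] # f" "length (concat f) = length f + 1" by auto
  with e(1) first_pair_block[of f 0] obtain q z w g
    where 2: "f = vertex q @ [z, w] # g" "length (concat g) = length g" by auto
  moreover have "g = vertex (concat g)"
    using 1 2 e(1) by (intro blocks_of_length_one) auto
  ultimately obtain s where "e = vertex p @ [x, y] # vertex q @ [z, w] # vertex s"
    using 1 by metis
  thus ?thesis using e(3) by (intro that) auto
qed

lemma edge_in_cells2:
  assumes "distinct (p @ x # y # s)" "set (p @ x # y # s) = S"
  shows "vertex p @ [x, y] # vertex s \<in> cells2 S 1"
proof -
  have "card S = length (p @ x # y # s)"
    using distinct_card[OF assms(1)] assms(2) by (simp del: set_append distinct_append list.set)
  moreover have "is_symbol (vertex p @ [x, y] # vertex s)"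
    using assms(1) by (auto simp: is_symbol_def)
  moreover have "length g \<le> 2" if "g \<in> set (vertex p @ [x, y] # vertex s)" for g
    using that by (auto simp: vertex_def)
  moreover have "concat (vertex p @ [x, y] # vertex s) = p @ x # y # s" by simp
  ultimately show ?thesis using assms(2) by (simp add: cells2_def del: set_concat)
qed

text \<open>With \<open>P\<close> the linear extension of the sorting paths, \<open>e - P (bd e)\<close> lies in the span for every edge \<open>e\<close>,
  hence so does \<open>c - P (bd c) = c\<close> for every cycle \<open>c\<close>.\<close>

lemma homology_subset_loop_span: "homology S 1 \<subseteq> loop_span S"
proof
  fix h assume "h \<in> homology S 1"
  then obtain c where c: "h = cls c" "keys c \<subseteq> cells2 S 1" "bd c = 0"
    by (auto simp: homology_def cycles_def)
  define P where "P = lin_ext (\<lambda>v. sort_path (rev (concat v)) [])"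
  have P_diff: "P (a - b) = P a - P b" for a b
    using lin_ext_add[of "\<lambda>v. sort_path (rev (concat v)) []" "a - b" b] unfolding P_def by (simp add: algebra_simps)
  have P_scale: "P (qscale q a) = qscale q (P a)" for q a
    by (simp add: P_def lin_ext_scale)
  have P_vertex: "P (single (vertex p @ [x] # [y] # vertex s) 1) = sort_path (rev s @ y # x # rev p) []" for p x y s
    by (simp add: P_def)
  have cell: "cls (single e 1 - P (bd_symbol e)) \<in> loop_span S" if "e \<in> cells2 S 1" for e
  proof -
    from that obtain p x y s where e: "e = vertex p @ [x, y] # vertex s"
      "distinct (p @ x # y # s)" "set (p @ x # y # s) = S" by (rule cells2_1_cases)
    have "cls (edge p x y s - P (bd (edge p x y s))) \<in> loop_span S"
      using sort_path_edge[of "rev s" y x "rev p" "[]" S] e(2,3)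
      by (simp add: bd_edge P_diff P_vertex cls_diff Int_commute Un_commute insert_commute)
    hence "hscale ((-1) ^ length p) (cls (edge p x y s - P (bd (edge p x y s)))) \<in> loop_span S"
      by (rule hv.subspace_scale[OF loop_span_subspace])
    thus ?thesis
      by (simp add: edge_def bd_single P_scale e flip: cls_scale power_mult_distrib
          add: qs.scale_right_diff_distrib)
  qed
  have "c = lin_ext (\<lambda>e. single e 1) c"
    by (rule poly_mapping_eqI) (auto simp: lin_ext_def lookup_sum lookup_single when_def in_keys_iff)
  moreover have "P (bd c) = lin_ext (\<lambda>e. P (bd_symbol e)) c"
    by (simp add: P_def bd_def lin_ext_lin_ext)
  moreover have "P (bd c) = 0" by (simp add: c P_def lin_ext_def)
  ultimately have "c = lin_ext (\<lambda>e. single e 1) c - lin_ext (\<lambda>e. P (bd_symbol e)) c" by simp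
  also have "\<dots> = (\<Sum>e\<in>keys c. qscale (lookup c e) (single e 1 - P (bd_symbol e)))"
    by (simp only: lin_ext_def sum_subtractf qs.scale_right_diff_distrib)
  finally have "h = (\<Sum>e\<in>keys c. hscale (lookup c e) (cls (single e 1 - P (bd_symbol e))))"
    unfolding c(1) by (metis (no_types, lifting) cls_sum cls_scale sum.cong)
  thus "h \<in> loop_span S"
    using cell c(2) by (auto intro!: hv.subspace_sum hv.subspace_scale loop_span_subspace)
qed


section \<open>The basic cycles as digons and hexagons\<close>

lemma pieces_vertex_append:
  assumes "\<And>x. pieces ([x] # e) = [[x]] # pieces e"
  shows "pieces (vertex p @ e) = map (\<lambda>x. [[x]]) p @ pieces e"
proof (induction p)
  case (Cons x p)
  thus ?case using assms by (cases p) auto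
qed simp

lemma foldr_cat_singletons:
  "foldr cat (map z_piece (map (\<lambda>x. [[x]]) p @ ps)) c
     = push ((@) (vertex p)) (foldr cat (map z_piece ps) c)"
proof (induction p)
  case Nil
  show ?case by (simp add: push_id)
next
  case (Cons x p)
  have "push ((@) [[x]]) (push ((@) (vertex p)) d) = push ((@) (vertex (x # p))) d" for d :: chain
    by (simp add: push_conv_lin_ext lin_ext_lin_ext append_Cons_fun)
  thus ?case using Cons by (simp add: cat_single_left append_Cons_fun)
qed

lemma pieces_vertex: "pieces (vertex s) = map (\<lambda>x. [[x]]) s"
  using pieces_vertex_append[of "[]" s] by simp

lemma foldr_cat_vertex:
  "foldr cat (map z_piece (map (\<lambda>x. [[x]]) s)) (single [] 1) = single (vertex s) 1"
  using foldr_cat_singletons[of s "[]" "single [] 1"] by simp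

text \<open>For \<open>a < b\<close> the two-element block is not part of a piece of three labels, whatever precedes it.\<close>

lemma digon_eq_z_chain:
  assumes "a < b"
  shows "digon p a b s = qscale ((-1) ^ length p) (z_chain (vertex p @ [a, b] # vertex s))"
proof -
  have "pieces ([x] # [a, b] # vertex s) = [[x]] # pieces ([a, b] # vertex s)" for x
    using assms by simp
  note 1 = pieces_vertex_append[of "[a, b] # vertex s", OF this]
  have "z_chain (vertex p @ [a, b] # vertex s)
      = single (vertex p @ [a, b] # vertex s) 1 + single (vertex p @ [b, a] # vertex s) 1"
    unfolding z_chain_def 1 foldr_cat_singletons
    by (simp add: pieces_vertex foldr_cat_vertex[unfolded map_map] cat_add_left push_add)
  thus ?thesis by (simp add: digon_def edge_def qs.scale_right_distrib)
qed

lemma hexagon_eq_z_chain: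
  assumes "a < b" "b < c"
  shows "hexagon p a b c s = qscale ((-1) ^ length p) (z_chain (vertex (p @ [a]) @ [c, b] # vertex s))"
proof -
  let ?e = "[a] # [c, b] # vertex s"
  have "pieces ([x] # ?e) = [[x]] # pieces ?e" for x
    by simp
  note 1 = pieces_vertex_append[of ?e, OF this]
  have 2: "z_piece [[a], [c, b]] = single [[c], [b, a]] 1 - single [[b], [c, a]] 1 + single [[a], [c, b]] 1
     + single [[c, b], [a]] 1 - single [[c, a], [b]] 1 + single [[b, a], [c]] 1"
    by (simp add: bd_block_321 relabel_def push_add push_diff cat_add_left cat_diff_left del: One_nat_def)
  have 3: "z_chain (vertex p @ ?e)
      = single (vertex (p @ [c]) @ [b, a] # vertex s) 1 - single (vertex (p @ [b]) @ [c, a] # vertex s) 1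
      + single (vertex (p @ [a]) @ [c, b] # vertex s) 1 + single (vertex p @ [c, b] # vertex (a # s)) 1
      - single (vertex p @ [c, a] # vertex (b # s)) 1 + single (vertex p @ [b, a] # vertex (c # s)) 1"
    using assms unfolding z_chain_def 1 foldr_cat_singletons
    by (simp add: pieces_vertex foldr_cat_vertex[unfolded map_map] cat_add_left cat_diff_left push_add push_diff 2 del: z_piece.simps)
  show ?thesis unfolding vertex_simps(3) append_assoc
    using 3
    by (simp add: hexagon_def edge_def qs.scale_right_distrib qs.scale_right_diff_distrib single_uminus)
qed


section \<open>Rearranging the words around a loop\<close>

lemma adjacent_swaps_invariant:
  assumes "\<And>u x y v. mset (u @ x # y # v) = mset xs \<Longrightarrow> f (u @ x # y # v) = f (u @ y # x # v)"
    and "mset xs = mset ys"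
  shows "f xs = f ys"
  using assms
proof (induction xs arbitrary: f ys)
  case (Cons a xs)
  have "a \<in> set ys" using Cons.prems(2) by (metis list.set_intros(1) set_mset_mset)
  then obtain u v where ys: "ys = u @ a # v" by (meson split_list)
  have uv: "mset xs = mset (u @ v)" using Cons.prems(2) ys by simp
  have move: "f (u @ a # v) = f (a # u @ v)" if "mset (u @ v) = mset xs" for u v
    using that
  proof (induction u arbitrary: v rule: rev_induct)
    case (snoc b u)
    have "f (u @ b # a # v) = f (u @ a # b # v)"
      using snoc.prems by (intro Cons.prems(1)) simp
    also have "\<dots> = f (a # u @ b # v)"
      using snoc.prems by (intro snoc.IH) simp
    finally show ?case by simp
  qed simp
  have "f (a # xs) = f (a # (u @ v))"
  proof (rule Cons.IH[OF _ uv])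
    fix u x y v assume "mset (u @ x # y # v) = mset xs"
    thus "f (a # u @ x # y # v) = f (a # u @ y # x # v)"
      using Cons.prems(1)[of "a # u" x y v] by simp
  qed
  thus ?case using move[of u v] uv ys by simp
qed simp

lemma edge_swap_left:
  assumes "distinct (p @ x # y # q @ z # w # s)"
  shows "cls (edge (p @ x # y # q) z w s) = cls (edge (p @ y # x # q) z w s)
       + cls (edge p x y (q @ z # w # s)) - cls (edge p x y (q @ w # z # s))"
  using square_relation[OF assms] by (simp add: algebra_simps)

lemma edge_swap_right:
  assumes "distinct (p @ x # y # q @ z # w # s)"
  shows "cls (edge p x y (q @ z # w # s)) = cls (edge p x y (q @ w # z # s))
       + cls (edge (p @ x # y # q) z w s) - cls (edge (p @ y # x # q) z w s)"
  using square_relation[OF assms] by (simp add: algebra_simps)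

text \<open>The square on the swap of \<open>x\<close> and \<open>y\<close> and the edge \<open>a b\<close> and that on the same swap and \<open>b a\<close> have the
  same edges for \<open>x y\<close> with opposite signs. In the sum only the digons remain.\<close>

lemma digon_permute_left:
  assumes "distinct (p @ a # b # s)" "mset p = mset p'"
  shows "cls (digon p a b s) = cls (digon p' a b s)"
proof (rule adjacent_swaps_invariant[OF _ assms(2)])
  fix u x y v assume "mset (u @ x # y # v) = mset p"
  hence "mset (u @ x # y # v @ a # b # s) = mset (p @ a # b # s)" by simp
  hence "distinct (u @ x # y # v @ a # b # s)" using assms(1) by (metis mset_eq_imp_distinct_iff)
  hence d: "distinct (u @ x # y # v @ a # b # s)" "distinct (u @ x # y # v @ b # a # s)" by auto
  show "cls (digon (u @ x # y # v) a b s) = cls (digon (u @ y # x # v) a b s)"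
    by (simp add: digon_def cls_add edge_swap_left[OF d(1)] edge_swap_left[OF d(2)])
qed

lemma digon_permute_right:
  assumes "distinct (p @ a # b # s)" "mset s = mset s'"
  shows "cls (digon p a b s) = cls (digon p a b s')"
proof (rule adjacent_swaps_invariant[OF _ assms(2)])
  fix u x y v assume "mset (u @ x # y # v) = mset s"
  hence "mset (p @ a # b # u @ x # y # v) = mset (p @ a # b # s)" by simp
  hence "distinct (p @ a # b # u @ x # y # v)" using assms(1) by (metis mset_eq_imp_distinct_iff)
  hence d: "distinct (p @ a # b # u @ x # y # v)" "distinct (p @ b # a # u @ x # y # v)" by auto
  show "cls (digon p a b (u @ x # y # v)) = cls (digon p a b (u @ y # x # v))"
    by (simp add: digon_def cls_add edge_swap_right[OF d(1)] edge_swap_right[OF d(2)])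
qed

text \<open>The six squares on the edges of the hexagon and the swap of \<open>x\<close> and \<open>y\<close> form a prism. Its edges for
  \<open>x y\<close> cancel in pairs, as the hexagon is a cycle.\<close>

lemma hexagon_permute_right:
  assumes "distinct (p @ a # b # c # s)" "mset s = mset s'"
  shows "cls (hexagon p a b c s) = cls (hexagon p a b c s')"
proof (rule adjacent_swaps_invariant[OF _ assms(2)])
  fix u x y v assume "mset (u @ x # y # v) = mset s"
  hence "mset (p @ a # b # c # u @ x # y # v) = mset (p @ a # b # c # s)" by simp
  hence "distinct (p @ a # b # c # u @ x # y # v)" using assms(1) by (metis mset_eq_imp_distinct_iff)
  hence d: "distinct (p @ b # a # (c # u) @ x # y # v)" "distinct (p @ c # a # (b # u) @ x # y # v)"
    "distinct (p @ c # b # (a # u) @ x # y # v)" "distinct ((p @ [c]) @ b # a # u @ x # y # v)"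
    "distinct ((p @ [b]) @ c # a # u @ x # y # v)" "distinct ((p @ [a]) @ c # b # u @ x # y # v)" by auto
  show "cls (hexagon p a b c (u @ x # y # v)) = cls (hexagon p a b c (u @ y # x # v))"
    using d[THEN edge_swap_right] by (simp add: hexagon_def cls_add cls_diff)
qed


section \<open>The symbols of the basis\<close>

text \<open>The symbols behind \<open>B_set\<close> and \<open>A_set\<close>, given by words instead of permutations (\<open>B_set_eq\<close>, \<open>A_set_eq\<close>).
  Keeping the symbols apart from their classes is necessary to count them before \<open>z_cls\<close> is known to be
  injective.\<close>

definition B_cells :: "nat \<Rightarrow> nat \<Rightarrow> symbol set"
  where "B_cells n m = {vertex p @ [a, b] # vertex s | p a b s. length p = m
    \<and> distinct (p @ a # b # s) \<and> set (p @ a # b # s) = {1..n}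
    \<and> sorted_wrt (>) p \<and> sorted_wrt (>) s \<and> a < b}"

definition A_cells :: "nat \<Rightarrow> nat \<Rightarrow> symbol set"
  where "A_cells n m = {vertex (p @ [a]) @ [c, b] # vertex s | p a b c s. Suc (length p) = m
    \<and> distinct (p @ a # b # c # s) \<and> set (p @ a # b # c # s) = {1..n}
    \<and> sorted_wrt (>) (p @ [a]) \<and> sorted_wrt (>) s \<and> a < b \<and> b < c}"

lemma upt_split:
  assumes "m + 2 \<le> n"
  shows "[1..<Suc n] = [1..<m + 1] @ (m + 1) # (m + 2) # [m + 3..<n + 1]"
proof -
  have "[1..<Suc n] = [1..<m + 1] @ [m + 1..<n + 1]"
    using upt_add_eq_append[of 1 "m + 1" "n - m"] assms by simp
  also have "[m + 1..<n + 1] = (m + 1) # (m + 2) # [m + 3..<n + 1]"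
    using assms by (simp add: upt_conv_Cons eval_nat_numeral)
  finally show ?thesis .
qed

lemma words_from_permutations:
  assumes "m + 2 \<le> n"
  shows "(distinct (p @ x # y # s) \<and> set (p @ x # y # s) = {1..n} \<and> length p = m) \<longleftrightarrow>
    (\<exists>i. i permutes {1..n} \<and> p = map i [1..<m + 1] \<and> x = i (m + 1) \<and> y = i (m + 2) \<and> s = map i [m + 3..<n + 1])"
    (is "?L \<longleftrightarrow> ?R")
proof
  assume ?R
  then obtain i where i: "i permutes {1..n}" "p = map i [1..<m + 1]" "x = i (m + 1)" "y = i (m + 2)"
    "s = map i [m + 3..<n + 1]" by blast
  have "p @ x # y # s = map i [1..<Suc n]"
    by (simp only: i(2-) upt_split[OF assms] map_append list.map)
  moreover have "inj_on i {1..<Suc n}"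
    using permutes_inj[OF i(1)] by (rule inj_on_subset) simp
  moreover have "i ` {1..<Suc n} = {1..n}"
    using permutes_image[OF i(1)] by (simp add: atLeastLessThanSuc_atLeastAtMost)
  ultimately show ?L using i(2) by (simp only: distinct_map set_map set_upt distinct_upt) simp
next
  assume L: ?L
  define l where "l = p @ x # y # s"
  have l: "distinct l" "set l = {1..n}" using L unfolding l_def by blast+
  have len: "length l = n" using distinct_card[OF l(1)] l(2) by simp
  define i where "i j = (if j \<in> {1..n} then l ! (j - 1) else j)" for j
  have map_i: "map i [1..<Suc n] = l"
    by (rule nth_equalityI) (auto simp: i_def len nth_append simp del: upt_Suc)
  have "bij_betw i {1..n} {1..n}"
  proof (rule bij_betw_imageI)
    show "i ` {1..n} = {1..n}"
      using arg_cong[OF map_i, of set] l(2) by (simp add: atLeastLessThanSuc_atLeastAtMost del: upt_Suc)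
    show "inj_on i {1..n}"
      using arg_cong[OF map_i, of distinct] l(1)
      by (simp add: distinct_map atLeastLessThanSuc_atLeastAtMost del: upt_Suc)
  qed
  hence "i permutes {1..n}"
    by (rule bij_imp_permutes) (auto simp: i_def)
  moreover have "p @ x # y # s = map i [1..<m + 1] @ i (m + 1) # i (m + 2) # map i [m + 3..<n + 1]"
    using map_i unfolding l_def upt_split[OF assms] by simp
  hence "p = map i [1..<m + 1] \<and> x = i (m + 1) \<and> y = i (m + 2) \<and> s = map i [m + 3..<n + 1]"
    using L by (subst (asm) append_eq_append_conv) auto
  ultimately show ?R by blast
qed

lemma sorted_map_upt:
  "sorted_wrt (>) (map i [k..<l]) \<longleftrightarrow> (\<forall>j\<in>{k..<l - 1}. i (j + 1) < (i j :: nat))"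
proof -
  have "sorted_wrt (>) (map i [k..<l]) \<longleftrightarrow> (\<forall>j. Suc j < l - k \<longrightarrow> i (k + Suc j) < i (k + j))"
    by (subst sorted_wrt_iff_nth_Suc_transp) (auto simp: transp_def)
  also have "\<dots> \<longleftrightarrow> (\<forall>j\<in>{k..<l - 1}. i (j + 1) < i j)"
  proof safe
    fix j assume "\<forall>j. Suc j < l - k \<longrightarrow> i (k + Suc j) < i (k + j)" "j \<in> {k..<l - 1}"
    thus "i (j + 1) < i j" by (auto dest: spec[of _ "j - k"])
  next
    fix j assume "\<forall>j\<in>{k..<l - 1}. i (j + 1) < i j" "Suc j < l - k"
    thus "i (k + Suc j) < i (k + j)" by (auto dest: bspec[of _ _ "k + j"])
  qed
  finally show ?thesis .
qed

lemma decreasing_outside_iff: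
  "decreasing_outside n m i \<longleftrightarrow> sorted_wrt (>) (map i [1..<m + 1]) \<and> sorted_wrt (>) (map i [m + 3..<n + 1])"
  unfolding sorted_map_upt decreasing_outside_def by simp

lemma one_block_symbol_eq:
  "one_block_symbol n m i
     = vertex (map i [1..<m + 1]) @ [i (m + 1), i (m + 2)] # vertex (map i [m + 3..<n + 1])"
  by (simp add: one_block_symbol_def vertex_def comp_def)

lemma B_cells_eq:
  assumes "m + 2 \<le> n"
  shows "B_cells n m = {one_block_symbol n m i | i.
    i permutes {1..n} \<and> decreasing_outside n m i \<and> i (m + 2) > i (m + 1)}"
proof -
  have "B_cells n m = {vertex p @ [a, b] # vertex s | p a b s.
     (\<exists>i. i permutes {1..n} \<and> p = map i [1..<m + 1] \<and> a = i (m + 1) \<and> b = i (m + 2) \<and> s = map i [m + 3..<n + 1])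
      \<and> sorted_wrt (>) p \<and> sorted_wrt (>) s \<and> a < b}"
    unfolding B_cells_def words_from_permutations[OF assms, symmetric] by blast
  thus ?thesis unfolding one_block_symbol_eq decreasing_outside_iff by blast
qed

lemma A_cells_eq:
  assumes "1 \<le> m" "m + 2 \<le> n"
  shows "A_cells n m = {one_block_symbol n m i | i.
    i permutes {1..n} \<and> decreasing_outside n m i \<and> i (m + 1) > i (m + 2) \<and> i (m + 2) > i m}"
proof -
  have "A_cells n m = {vertex q @ [c, b] # vertex s | q c b s.
      (distinct (q @ c # b # s) \<and> set (q @ c # b # s) = {1..n} \<and> length q = m)
      \<and> sorted_wrt (>) q \<and> sorted_wrt (>) s \<and> last q < b \<and> b < c}" (is "_ = ?X")
  proof (intro equalityI subsetI)
    fix e assume "e \<in> A_cells n m"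
    then obtain p a b c s where e: "e = vertex (p @ [a]) @ [c, b] # vertex s" "Suc (length p) = m"
      "distinct (p @ a # b # c # s)" "set (p @ a # b # c # s) = {1..n}"
      "sorted_wrt (>) (p @ [a])" "sorted_wrt (>) s" "a < b" "b < c" unfolding A_cells_def by blast
    have "distinct ((p @ [a]) @ c # b # s)" "set ((p @ [a]) @ c # b # s) = {1..n}"
      "length (p @ [a]) = m" "last (p @ [a]) < b" using e by auto
    thus "e \<in> ?X" using e by blast
  next
    fix e assume "e \<in> ?X"
    then obtain q c b s where e: "e = vertex q @ [c, b] # vertex s" "distinct (q @ c # b # s)"
      "set (q @ c # b # s) = {1..n}" "length q = m" "sorted_wrt (>) q" "sorted_wrt (>) s" "last q < b" "b < c"
      by blast
    define p where "p = butlast q"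
    define a where "a = last q"
    have q: "q = p @ [a]" using e(4) assms(1) unfolding p_def a_def by (intro append_butlast_last_id[symmetric]) auto
    have "Suc (length p) = m" "distinct (p @ a # b # c # s)" "set (p @ a # b # c # s) = {1..n}"
      using e(2,3,4) unfolding q by auto
    thus "e \<in> A_cells n m" using e(1,5-8) unfolding q A_cells_def last_snoc by blast
  qed
  moreover have "last (map i [1..<m + 1]) = i m" for i :: "nat \<Rightarrow> nat"
    using assms(1) by (simp add: last_map)
  ultimately show ?thesis
    unfolding one_block_symbol_eq decreasing_outside_iff words_from_permutations[OF assms(2)]
    by (smt (verit, ccfv_SIG) Collect_cong)
qed

lemma B_set_eq: "m + 2 \<le> n \<Longrightarrow> B_set n m = z_cls ` B_cells n m"
  unfolding B_set_def by (simp only: B_cells_eq) blast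

lemma A_set_eq: "1 \<le> m \<Longrightarrow> m + 2 \<le> n \<Longrightarrow> A_set n m = z_cls ` A_cells n m"
  unfolding A_set_def by (simp only: A_cells_eq) blast

lemma finite_cells:
  "m + 2 \<le> n \<Longrightarrow> finite (B_cells n m)" "1 \<le> m \<Longrightarrow> m + 2 \<le> n \<Longrightarrow> finite (A_cells n m)"
  by (simp_all only: B_cells_eq A_cells_eq) (auto intro!: finite_image_set intro: finite_subset[OF _ finite_permutations[of "{1..n}"]])

definition basis_cells :: "nat \<Rightarrow> symbol set"
  where "basis_cells n = (\<Union>m\<in>{1..n - 2}. A_cells n m) \<union> (\<Union>m\<in>{0..n - 2}. B_cells n m)"

lemma descending_rearrangement:
  fixes p :: "nat list" assumes "distinct p"
  obtains q where "mset q = mset p" "sorted_wrt (>) q" "distinct q" "set q = set p" "length q = length p"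
proof
  show "sorted_wrt (>) (rev (sort p))"
    using assms by (simp add: sorted_wrt_rev strict_sorted_iff)
qed (use assms in simp_all)

text \<open>It remains to sort the words around digons and after hexagons; a digon is symmetric in its two labels,
  so that \<open>a < b\<close> may be assumed.\<close>

lemma loop_span_subset_span: "loop_span {1..n} \<subseteq> hv.span (z_cls ` basis_cells n)"
  unfolding loop_span_def
proof (intro hv.span_minimal[OF _ hv.subspace_span] Un_least subsetI)
  have dig: "cls (digon p a b s) \<in> hv.span (z_cls ` basis_cells n)"
    if d: "distinct (p @ a # b # s)" "set (p @ a # b # s) = {1..n}" and "a < b" for p a b s
  proof -
    obtain p' where p': "mset p' = mset p" "sorted_wrt (>) p'" "distinct p'" "set p' = set p" "length p' = length p"
      using d by (auto elim!: descending_rearrangement[of p])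
    obtain s' where s': "mset s' = mset s" "sorted_wrt (>) s'" "distinct s'" "set s' = set s" "length s' = length s"
      using d by (auto elim!: descending_rearrangement[of s])
    have d': "distinct (p' @ a # b # s')" "set (p' @ a # b # s') = {1..n}"
      using d p' s' by auto
    have "length (p' @ a # b # s') = n" using distinct_card[OF d'(1)] d'(2) by simp
    hence "vertex p' @ [a, b] # vertex s' \<in> basis_cells n"
      using d' p' s' \<open>a < b\<close> unfolding basis_cells_def B_cells_def
      by (intro UnI2 UN_I[of "length p'"]) (simp, blast)
    moreover have "cls (digon p a b s) = cls (digon p' a b s')"
      using d p' s' by (metis digon_permute_left digon_permute_right d'(1) distinct_append mset_append mset_eq_imp_distinct_iff)
    ultimately show ?thesis
      using hv.span_scale[OF hv.span_base[OF imageI]]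
      by (simp only: digon_eq_z_chain[OF \<open>a < b\<close>] cls_scale flip: z_cls_def)
  qed
  fix h assume "h \<in> {cls (digon p a b s) | p a b s. distinct (p @ a # b # s) \<and> set (p @ a # b # s) = {1..n}}"
  then obtain p a b s where h: "h = cls (digon p a b s)"
    and d: "distinct (p @ a # b # s)" "set (p @ a # b # s) = {1..n}" by blast
  have "cls (digon p a b s) \<in> hv.span (z_cls ` basis_cells n)"
  proof (cases "a < b")
    case False
    hence "cls (digon p b a s) \<in> hv.span (z_cls ` basis_cells n)"
      using d by (intro dig) auto
    thus ?thesis by (simp add: digon_def add.commute)
  qed (rule dig[OF d])
  thus "h \<in> hv.span (z_cls ` basis_cells n)" by (simp only: h)
next
  fix h assume "h \<in> {cls (hexagon p a b c s) | p a b c s. distinct (p @ a # b # c # s)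
    \<and> set (p @ a # b # c # s) = {1..n} \<and> sorted_wrt (>) (p @ [a]) \<and> a < b \<and> b < c}"
  then obtain p a b c s where h: "h = cls (hexagon p a b c s)"
    and d: "distinct (p @ a # b # c # s)" "set (p @ a # b # c # s) = {1..n}"
    and pa: "sorted_wrt (>) (p @ [a])" and "a < b" "b < c" by blast
  obtain s' where s': "mset s' = mset s" "sorted_wrt (>) s'" "distinct s'" "set s' = set s" "length s' = length s"
    using d by (auto elim!: descending_rearrangement[of s])
  have d': "distinct (p @ a # b # c # s')" "set (p @ a # b # c # s') = {1..n}"
    using d s' by auto
  have "length (p @ a # b # c # s') = n" using distinct_card[OF d'(1)] d'(2) by simp
  hence "vertex (p @ [a]) @ [c, b] # vertex s' \<in> basis_cells n"
    using d' pa s' \<open>a < b\<close> \<open>b < c\<close> unfolding basis_cells_def A_cells_def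
    by (intro UnI1 UN_I[of "Suc (length p)"]) (simp, blast)
  moreover have "cls (hexagon p a b c s) = cls (hexagon p a b c s')"
    using d s' by (intro hexagon_permute_right) auto
  ultimately show "h \<in> hv.span (z_cls ` basis_cells n)"
    unfolding h
    using hv.span_scale[OF hv.span_base[OF imageI]]
    by (simp only: hexagon_eq_z_chain[OF \<open>a < b\<close> \<open>b < c\<close>] cls_scale flip: z_cls_def)
qed


section \<open>Cocycles depending on the set to the left\<close>

text \<open>The sign is the one in \<open>edge\<close>, so that the value on \<open>edge p x y s\<close> is \<open>G (set p) x y\<close>.\<close>

definition weight :: "(nat set \<Rightarrow> nat \<Rightarrow> nat \<Rightarrow> rat) \<Rightarrow> symbol \<Rightarrow> rat"
  where "weight G e = (let p = takeWhile (\<lambda>g. length g = 1) e; g = e ! length p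
    in (-1) ^ length p * G (set (concat p)) (g ! 0) (g ! 1))"

text \<open>The linear extension of \<open>weight G\<close>, with \<open>unit \<Rightarrow>\<^sub>0 rat\<close> in the role of the rationals.\<close>

definition pairing :: "(nat set \<Rightarrow> nat \<Rightarrow> nat \<Rightarrow> rat) \<Rightarrow> chain \<Rightarrow> rat"
  where "pairing G c = lookup (lin_ext (\<lambda>e. single () (weight G e)) c) ()"

lemma pairing_add: "pairing G (c + d) = pairing G c + pairing G d"
  by (simp add: pairing_def lin_ext_add lookup_add)

lemma pairing_scale: "pairing G (qscale q c) = q * pairing G c"
  by (simp add: pairing_def lin_ext_scale)

lemma pairing_diff: "pairing G (c - d) = pairing G c - pairing G d"
  using pairing_add[of G "c - d" d] by simp

lemma pairing_sum: "pairing G (\<Sum>x\<in>A. f x) = (\<Sum>x\<in>A. pairing G (f x))"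
  by (simp add: pairing_def lin_ext_sum lookup_sum)

lemma takeWhile_vertex: "takeWhile (\<lambda>g. length g = 1) (vertex p @ [x, y] # e) = vertex p"
  by (subst takeWhile_append2) (auto simp: vertex_def)

lemma pairing_edge [simp]: "pairing G (edge p x y s) = G (set p) x y"
proof -
  let ?e = "vertex p @ [x, y] # vertex s"
  have "weight G ?e = (-1) ^ length p * G (set p) x y"
    unfolding weight_def takeWhile_vertex by (simp add: nth_append del: set_concat)
  thus ?thesis by (simp add: pairing_def edge_def flip: power_mult_distrib mult.assoc)
qed

text \<open>Opposite edges of a square have the same two labels in the block and the same set of labels to the left.\<close>

lemma pairing_boundary:
  assumes "c \<in> boundaries S 1"
  shows "pairing G c = 0"
proof -
  obtain x where x: "c = bd x" "keys x \<subseteq> cells2 S 2"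
    using assms by (auto simp: boundaries_def numeral_2_eq_2)
  have "pairing G (bd_symbol e) = 0" if "e \<in> cells2 S 2" for e
  proof -
    from that obtain p x y q z w s where e: "e = vertex p @ [x, y] # vertex q @ [z, w] # vertex s"
      "distinct (p @ x # y # q @ z # w # s)" by (rule cells2_2_cases)
    have "pairing G (bd (single e ((-1) ^ length q))) = 0"
      using e(2) unfolding e(1) by (subst bd_square) (auto simp: pairing_add pairing_diff insert_commute)
    thus ?thesis by (simp add: bd_single pairing_scale)
  qed
  thus ?thesis using x
    by (auto simp: bd_def lin_ext_def pairing_sum pairing_scale intro!: sum.neutral)
qed

text \<open>On a digon with \<open>a < b\<close> this selects the increasing one of the two edges, whereas all edges of a hexagon
  are decreasing.\<close>

definition dual_digon :: "nat set \<Rightarrow> nat \<Rightarrow> nat \<Rightarrow> nat set \<Rightarrow> nat \<Rightarrow> nat \<Rightarrow> rat"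
  where "dual_digon P a b = (\<lambda>L x y. if L = P \<and> x = a \<and> y = b then 1 else 0)"

text \<open>Antisymmetry in the labels of the edge makes this vanish on digons. A hexagon contains the edge \<open>c b\<close> with
  \<open>P\<close> and with \<open>insert a P\<close> to the left, with opposite signs. The condition on \<open>L\<close> ignores
  labels below \<open>a\<close>, so a hexagon whose least label is below \<open>a\<close> contributes twice the same value with
  opposite signs.\<close>

definition dual_hexagon :: "nat set \<Rightarrow> nat \<Rightarrow> nat \<Rightarrow> nat \<Rightarrow> nat set \<Rightarrow> nat \<Rightarrow> nat \<Rightarrow> rat"
  where "dual_hexagon P a b c = (\<lambda>L x y. if L \<inter> {a..} = insert a P then
     (if x = c \<and> y = b then 1 else if x = b \<and> y = c then -1 else 0) else 0)"

lemma pairing_digon: "pairing G (digon p a b s) = G (set p) a b + G (set p) b a"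
  by (simp add: digon_def pairing_add)

lemma pairing_hexagon:
  "pairing G (hexagon p a b c s) = G (set p) b a - G (insert c (set p)) b a
     - (G (set p) c a - G (insert b (set p)) c a) + (G (set p) c b - G (insert a (set p)) c b)"
  by (simp add: hexagon_def pairing_add pairing_diff)

lemma dual_digon_digon:
  assumes "a < b" "a0 < b0"
  shows "pairing (dual_digon P a0 b0) (digon p a b s) = (if set p = P \<and> a = a0 \<and> b = b0 then 1 else 0)"
  using assms by (simp add: pairing_digon dual_digon_def)

lemma dual_digon_hexagon:
  assumes "a < b" "b < c" "a0 < b0"
  shows "pairing (dual_digon P a0 b0) (hexagon p a b c s) = 0"
  using assms by (simp add: pairing_hexagon dual_digon_def)

lemma dual_hexagon_digon:
  assumes "b0 < c0"
  shows "pairing (dual_hexagon P a0 b0 c0) (digon p a b s) = 0"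
  using assms by (simp add: pairing_digon dual_hexagon_def)

text \<open>An edge of a hexagon that has the least label \<open>a\<close> in its block has weight zero: all labels to its left exceed
  \<open>a\<close>, which would have to be \<open>b0 > a0\<close>, so \<open>a0\<close> is not among them. Of the two remaining edges
  \<open>c b\<close>, the one preceded by \<open>set p\<close> differs from the other only in the label \<open>a\<close>.\<close>

lemma dual_hexagon_hexagon:
  assumes "\<forall>x\<in>set p. a < x" "a < b" "b < c" "\<forall>x\<in>P. a0 < x" "a0 < b0" "b0 < c0"
  shows "pairing (dual_hexagon P a0 b0 c0) (hexagon p a b c s)
    = (if set p = P \<and> a = a0 \<and> b = b0 \<and> c = c0 then -1 else 0)"
proof -
  let ?G = "dual_hexagon P a0 b0 c0"
  have min: "?G L x a = 0" if "\<forall>y\<in>L. a < y" "a < x" for L x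
  proof -
    have "L \<inter> {a0..} \<noteq> insert a0 P" if "a = b0"
      using \<open>\<forall>y\<in>L. a < y\<close> \<open>a = b0\<close> assms(5) by (metis Int_iff insertI1 less_asym)
    thus ?thesis using that(2) assms(6) by (simp add: dual_hexagon_def)
  qed
  have zero: "?G (set p) b a = 0" "?G (insert c (set p)) b a = 0" "?G (set p) c a = 0"
    "?G (insert b (set p)) c a = 0"
    by (rule min; use assms in simp)+
  have "?G (set p) c b - ?G (insert a (set p)) c b
    = (if set p = P \<and> a = a0 \<and> b = b0 \<and> c = c0 then -1 else 0)"
  proof (cases "a0 \<le> a")
    case False
    hence "insert a (set p) \<inter> {a0..} = set p \<inter> {a0..}" by auto
    thus ?thesis using False by (simp add: dual_hexagon_def)
  next
    case True
    have lt: "a0 < x" if "x \<in> set p" for x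
      using assms(1) that True by (meson le_less_trans)
    have "set p \<subseteq> {a0..}" using lt by (meson atLeast_iff less_imp_le subsetI)
    hence 1: "set p \<inter> {a0..} = set p" "insert a (set p) \<inter> {a0..} = insert a (set p)"
      using True by (simp_all add: Int_absorb2)
    have notin: "a0 \<notin> set p" "a \<notin> set p" "a0 \<notin> P"
      using lt assms(1,4) by (meson less_irrefl)+
    hence 2: "set p \<noteq> insert a0 P" by blast
    have 3: "insert a (set p) = insert a0 P \<longleftrightarrow> set p = P \<and> a = a0"
      using notin by (metis insertE insertI1 insert_ident)
    show ?thesis using assms(2,3,5,6) by (simp add: dual_hexagon_def 1 2 3)
  qed
  thus ?thesis by (simp only: pairing_hexagon zero)
qed

lemma decreasing_unique:
  fixes p q :: "nat list"
  assumes "sorted_wrt (>) p" "sorted_wrt (>) q" "set p = set q"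
  shows "p = q"
proof -
  have "rev p = rev q"
    using assms by (intro strict_sorted_equal) (simp_all add: sorted_wrt_rev)
  thus ?thesis by simp
qed

lemma basis_cells_cases:
  assumes "e \<in> basis_cells n"
  obtains (digon) p a b s where "e = vertex p @ [a, b] # vertex s"
      "distinct (p @ a # b # s)" "set (p @ a # b # s) = {1..n}"
      "sorted_wrt (>) p" "sorted_wrt (>) s" "a < b"
    | (hexagon) p a b c s where "e = vertex (p @ [a]) @ [c, b] # vertex s"
      "distinct (p @ a # b # c # s)" "set (p @ a # b # c # s) = {1..n}"
      "sorted_wrt (>) p" "\<forall>x\<in>set p. a < x" "sorted_wrt (>) s" "a < b" "b < c"
proof (cases "e \<in> (\<Union>m\<in>{0..n - 2}. B_cells n m)")
  case True
  then obtain p a b s where "e = vertex p @ [a, b] # vertex s" "distinct (p @ a # b # s)"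
    "set (p @ a # b # s) = {1..n}" "sorted_wrt (>) p" "sorted_wrt (>) s" "a < b"
    unfolding B_cells_def by blast
  thus ?thesis by (rule digon)
next
  case False
  then obtain m where "e \<in> A_cells n m" using assms unfolding basis_cells_def by blast
  then obtain p a b c s where e: "e = vertex (p @ [a]) @ [c, b] # vertex s"
    "distinct (p @ a # b # c # s)" "set (p @ a # b # c # s) = {1..n}"
    "sorted_wrt (>) (p @ [a])" "sorted_wrt (>) s" "a < b" "b < c"
    unfolding A_cells_def by blast
  from e(4) have "sorted_wrt (>) p" "\<forall>x\<in>set p. a < x" by (simp_all add: sorted_wrt_append)
  with e show ?thesis by (intro hexagon)
qed

lemma pairing_z_chain_digon:
  "a < b \<Longrightarrow> pairing G (z_chain (vertex p @ [a, b] # vertex s)) = 0 \<longleftrightarrow> pairing G (digon p a b s) = 0"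
  by (simp add: digon_eq_z_chain pairing_scale)

lemma pairing_z_chain_hexagon:
  "a < b \<Longrightarrow> b < c \<Longrightarrow> pairing G (z_chain (vertex (p @ [a]) @ [c, b] # vertex s)) = 0
     \<longleftrightarrow> pairing G (hexagon p a b c s) = 0"
  by (simp add: hexagon_eq_z_chain pairing_scale)

lemma dual_weight:
  assumes "e \<in> basis_cells n"
  obtains G where "pairing G (z_chain e) \<noteq> 0"
    "\<And>f. f \<in> basis_cells n \<Longrightarrow> f \<noteq> e \<Longrightarrow> pairing G (z_chain f) = 0"
  using assms
proof (cases rule: basis_cells_cases)
  case (digon p a b s)
  let ?G = "dual_digon (set p) a b"
  show ?thesis
  proof (rule that[of ?G])
    show "pairing ?G (z_chain e) \<noteq> 0"
      unfolding digon(1) pairing_z_chain_digon[OF digon(6)] dual_digon_digon[OF digon(6) digon(6)] by simp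
    fix f assume "f \<in> basis_cells n" "f \<noteq> e"
    thus "pairing ?G (z_chain f) = 0"
    proof (cases rule: basis_cells_cases)
      case f: (digon p' a' b' s')
      have "\<not> (set p' = set p \<and> a' = a \<and> b' = b)"
      proof
        assume eq: "set p' = set p \<and> a' = a \<and> b' = b"
        have "set s = {1..n} - set p - {a, b}" "set s' = {1..n} - set p' - {a', b'}"
          using digon(2,3) f(2,3) by auto
        hence "set s' = set s" using eq by simp
        with f(5) digon(5) have "s' = s" by (rule decreasing_unique)
        moreover have "p' = p" using f(4) digon(4) eq by (intro decreasing_unique) blast+
        ultimately show False using eq f(1) digon(1) \<open>f \<noteq> e\<close> by simp
      qed
      thus ?thesis
        unfolding f(1) pairing_z_chain_digon[OF f(6)] dual_digon_digon[OF f(6) digon(6)] by simp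
    next
      case f: (hexagon p' a' b' c' s')
      show ?thesis
        unfolding f(1) pairing_z_chain_hexagon[OF f(7,8)] by (rule dual_digon_hexagon[OF f(7,8) digon(6)])
    qed
  qed
next
  case (hexagon p a b c s)
  let ?G = "dual_hexagon (set p) a b c"
  show ?thesis
  proof (rule that[of ?G])
    show "pairing ?G (z_chain e) \<noteq> 0"
      unfolding hexagon(1) pairing_z_chain_hexagon[OF hexagon(7,8)]
        dual_hexagon_hexagon[OF hexagon(5,7,8,5,7,8)] by simp
    fix f assume "f \<in> basis_cells n" "f \<noteq> e"
    thus "pairing ?G (z_chain f) = 0"
    proof (cases rule: basis_cells_cases)
      case f: (digon p' a' b' s')
      show ?thesis
        unfolding f(1) pairing_z_chain_digon[OF f(6)] by (rule dual_hexagon_digon[OF hexagon(8)])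
    next
      case f: (hexagon p' a' b' c' s')
      have "\<not> (set p' = set p \<and> a' = a \<and> b' = b \<and> c' = c)"
      proof
        assume eq: "set p' = set p \<and> a' = a \<and> b' = b \<and> c' = c"
        have "set s = {1..n} - set p - {a, b, c}" "set s' = {1..n} - set p' - {a', b', c'}"
          using hexagon(2,3) f(2,3) by auto
        hence "set s' = set s" using eq by simp
        with f(6) hexagon(6) have "s' = s" by (rule decreasing_unique)
        moreover have "p' = p" using f(4) hexagon(4) eq by (intro decreasing_unique) blast+
        ultimately show False using eq f(1) hexagon(1) \<open>f \<noteq> e\<close> by simp
      qed
      thus ?thesis
        unfolding f(1) pairing_z_chain_hexagon[OF f(7,8)] dual_hexagon_hexagon[OF f(5,7,8) hexagon(5,7,8)]
        by simp
    qed
  qed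
qed


section \<open>Digons and hexagons are cycles\<close>

lemma keys_add_subset: "keys c \<subseteq> K \<Longrightarrow> keys d \<subseteq> K \<Longrightarrow> keys (c + d) \<subseteq> K"
  for c d :: chain
  by (rule order_trans[OF keys_add Un_least])

lemma keys_diff_subset: "keys c \<subseteq> K \<Longrightarrow> keys d \<subseteq> K \<Longrightarrow> keys (c - d) \<subseteq> K"
  for c d :: chain
proof
  fix e assume sub: "keys c \<subseteq> K" "keys d \<subseteq> K" and e: "e \<in> keys (c - d)"
  from e have "lookup c e \<noteq> lookup d e" by (simp add: in_keys_iff lookup_minus)
  hence "lookup c e \<noteq> 0 \<or> lookup d e \<noteq> 0" by metis
  hence "e \<in> keys c \<or> e \<in> keys d" by (simp add: in_keys_iff)
  thus "e \<in> K" using sub by blast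
qed

lemma keys_edge:
  assumes "distinct (p @ x # y # s)" "set (p @ x # y # s) = S"
  shows "keys (edge p x y s) \<subseteq> cells2 S 1"
  using edge_in_cells2[OF assms] by (simp add: edge_def)

lemma digon_cycle:
  assumes "distinct (p @ a # b # s)" "set (p @ a # b # s) = S"
  shows "digon p a b s \<in> cycles S 1"
proof -
  have "keys (edge p a b s) \<subseteq> cells2 S 1" "keys (edge p b a s) \<subseteq> cells2 S 1"
    by (rule keys_edge; use assms in \<open>simp add: insert_commute\<close>)+
  hence "keys (digon p a b s) \<subseteq> cells2 S 1"
    unfolding digon_def by (rule keys_add_subset)
  moreover have "a \<noteq> b" using assms(1) by simp
  hence "bd (digon p a b s) = 0" by (simp add: digon_def bd.add bd_edge)
  ultimately show ?thesis by (simp add: cycles_def)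
qed

lemma hexagon_cycle:
  assumes "distinct (p @ a # b # c # s)" "set (p @ a # b # c # s) = S"
  shows "hexagon p a b c s \<in> cycles S 1"
proof -
  have "a \<noteq> b" "a \<noteq> c" "b \<noteq> c" using assms(1) by simp_all
  hence "bd (hexagon p a b c s) = 0" by (simp add: hexagon_def bd.add bd.diff bd_edge)
  moreover have "distinct (p @ b # a # c # s)" "distinct (p @ c # a # b # s)" "distinct (p @ c # b # a # s)"
    "distinct ((p @ [c]) @ b # a # s)" "distinct ((p @ [b]) @ c # a # s)" "distinct ((p @ [a]) @ c # b # s)"
    using assms(1) by auto
  moreover have "set (p @ b # a # c # s) = S" "set (p @ c # a # b # s) = S" "set (p @ c # b # a # s) = S"
    "set ((p @ [c]) @ b # a # s) = S" "set ((p @ [b]) @ c # a # s) = S" "set ((p @ [a]) @ c # b # s) = S"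
    unfolding assms(2)[symmetric] by auto
  ultimately have "keys (hexagon p a b c s) \<subseteq> cells2 S 1"
    unfolding hexagon_def by (intro keys_add_subset keys_diff_subset keys_edge)
  thus ?thesis using \<open>bd (hexagon p a b c s) = 0\<close> by (simp add: cycles_def)
qed

lemma cycles_subspace: "qs.subspace (cycles S k)"
proof (rule qs.subspaceI)
  fix x y :: chain and q :: rat
  show "0 \<in> cycles S k" by (simp add: cycles_def)
  show "x + y \<in> cycles S k" if "x \<in> cycles S k" "y \<in> cycles S k"
    using that unfolding cycles_def mem_Collect_eq bd.add by (simp add: keys_add_subset)
  show "qscale q x \<in> cycles S k" if "x \<in> cycles S k"
  proof -
    have "keys (qscale q x) \<subseteq> keys x" by (rule subsetI) (simp add: in_keys_iff)
    thus ?thesis using that unfolding cycles_def mem_Collect_eq bd.scale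
      by (metis order_trans qs.scale_zero_right)
  qed
qed

lemma z_chain_cycle:
  assumes "e \<in> basis_cells n"
  shows "z_chain e \<in> cycles {1..n} 1"
proof -
  have scale: "c \<in> cycles S k" if "qscale ((-1) ^ l) c \<in> cycles S k" for c S k l
  proof -
    have "(-1) ^ l * (-1) ^ l = (1 :: rat)" by (simp flip: power_mult_distrib)
    thus ?thesis using qs.subspace_scale[OF cycles_subspace that, of "(-1) ^ l"]
      by (simp only: qs.scale_scale qs.scale_one)
  qed
  show ?thesis using assms
  proof (cases rule: basis_cells_cases)
    case (digon p a b s)
    show ?thesis using digon_cycle[OF digon(2,3)]
      unfolding digon(1) digon_eq_z_chain[OF digon(6)] by (rule scale)
  next
    case (hexagon p a b c s)
    show ?thesis using hexagon_cycle[OF hexagon(2,3)]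
      unfolding hexagon(1) hexagon_eq_z_chain[OF hexagon(7,8)] by (rule scale)
  qed
qed


section \<open>The basis theorem in degree one\<close>

lemma finite_basis_cells: "finite (basis_cells n)"
proof (rule finite_subset)
  show "basis_cells n \<subseteq> {e. set e \<subseteq> {g. set g \<subseteq> {1..n} \<and> length g \<le> 2} \<and> length e \<le> n}"
  proof
    fix e assume "e \<in> basis_cells n"
    thus "e \<in> {e. set e \<subseteq> {g. set g \<subseteq> {1..n} \<and> length g \<le> 2} \<and> length e \<le> n}"
    proof (cases rule: basis_cells_cases)
      case (digon p a b s)
      hence "e \<in> cells2 {1..n} 1" by (simp only: edge_in_cells2)
      thus ?thesis by (auto simp: cells2_def)
    next
      case (hexagon p a b c s)
      have "distinct ((p @ [a]) @ c # b # s)" "set ((p @ [a]) @ c # b # s) = {1..n}"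
        using hexagon(2,3) by auto
      hence "e \<in> cells2 {1..n} 1" unfolding hexagon(1) by (rule edge_in_cells2)
      thus ?thesis by (auto simp: cells2_def)
    qed
  qed
  show "finite {e. set e \<subseteq> {g. set g \<subseteq> {1..n} \<and> length g \<le> 2} \<and> length e \<le> n}"
    by (intro finite_lists_length_le) simp
qed

lemma card_basis_cells:
  assumes "\<And>m. m \<in> {1..n - 2} \<Longrightarrow> finite (A_cells n m)" "\<And>m. m \<in> {0..n - 2} \<Longrightarrow> finite (B_cells n m)"
  shows "card (basis_cells n) = (\<Sum>m\<in>{1..n - 2}. card (A_cells n m)) + (\<Sum>m\<in>{0..n - 2}. card (B_cells n m))"
proof -
  \<comment> \<open>The union is disjoint: the position of the two-element block gives \<open>m\<close>, its order tells the two families apart.\<close>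
  define pos where "pos e = length (takeWhile (\<lambda>g. length g = 1) e)" for e :: symbol
  define asc where "asc e = (e ! pos e ! 0 < e ! pos e ! 1)" for e
  have pos: "pos (vertex p @ [x, y] # e) = length p" for p x y e
    unfolding pos_def takeWhile_vertex by simp
  have asc: "asc (vertex p @ [x, y] # e) \<longleftrightarrow> x < y" for p x y e
    unfolding asc_def pos by (simp add: nth_append)
  have A: "pos e = m \<and> \<not> asc e" if "e \<in> A_cells n m" for e m
  proof -
    from that obtain p a b c s where "e = vertex (p @ [a]) @ [c, b] # vertex s" "Suc (length p) = m" "b < c"
      unfolding A_cells_def by blast
    thus ?thesis by (simp only: pos asc) simp
  qed
  have B: "pos e = m \<and> asc e" if "e \<in> B_cells n m" for e m
  proof -
    from that obtain p a b s where "e = vertex p @ [a, b] # vertex s" "length p = m" "a < b"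
      unfolding B_cells_def by blast
    thus ?thesis by (simp only: pos asc)
  qed
  have "card (\<Union>m\<in>{1..n - 2}. A_cells n m) = (\<Sum>m\<in>{1..n - 2}. card (A_cells n m))"
    using assms(1) A by (intro card_UN_disjoint) blast+
  moreover have "card (\<Union>m\<in>{0..n - 2}. B_cells n m) = (\<Sum>m\<in>{0..n - 2}. card (B_cells n m))"
    using assms(2) B by (intro card_UN_disjoint) blast+
  moreover have "card (basis_cells n)
      = card (\<Union>m\<in>{1..n - 2}. A_cells n m) + card (\<Union>m\<in>{0..n - 2}. B_cells n m)"
    unfolding basis_cells_def using assms A B by (intro card_Un_disjoint) blast+
  ultimately show ?thesis by simp
qed

text \<open>A vanishing combination of classes is represented by a boundary. The dual weight of \<open>e\<close> vanishes on it and on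
  all basic cycles other than that of \<open>e\<close>.\<close>

lemma z_cls_cells_independent:
  assumes "(\<Sum>e\<in>basis_cells n. hscale (u e) (z_cls e)) = 0" "e \<in> basis_cells n"
  shows "u e = 0"
proof -
  let ?y = "\<Sum>e\<in>basis_cells n. qscale (u e) (z_chain e)"
  have "cls ?y = 0" using assms(1) by (simp add: cls_sum cls_scale z_cls_def)
  hence "cls ?y = cls 0" by (simp add: cls_zero)
  moreover have "?y \<in> cycles {1..n} 1"
    by (intro qs.subspace_sum qs.subspace_scale cycles_subspace z_chain_cycle)
  moreover have "0 \<in> cycles {1..n} 1" by (rule qs.subspace_0[OF cycles_subspace])
  ultimately have y: "?y \<in> boundaries {1..n} 1"
    using cls_eq_iff[of ?y "{1..n}" 1 0] by simp
  obtain G where G: "pairing G (z_chain e) \<noteq> 0"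
    "\<And>f. f \<in> basis_cells n \<Longrightarrow> f \<noteq> e \<Longrightarrow> pairing G (z_chain f) = 0"
    using dual_weight[OF assms(2)] by blast
  have fin: "finite (basis_cells n)" by (rule finite_basis_cells)
  have "0 = pairing G ?y" using pairing_boundary[OF y] by simp
  also have "\<dots> = (\<Sum>f\<in>basis_cells n. u f * pairing G (z_chain f))"
    by (simp add: pairing_sum pairing_scale)
  also have "\<dots> = u e * pairing G (z_chain e)"
    using fin assms(2) G(2) by (subst sum.remove[of _ e]) (auto intro!: sum.neutral)
  finally show ?thesis using G(1) by simp
qed

lemma inj_on_z_cls: "inj_on z_cls (basis_cells n)"
proof (rule inj_onI, rule ccontr)
  fix e f assume ef: "e \<in> basis_cells n" "f \<in> basis_cells n" "z_cls e = z_cls f" "e \<noteq> f"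
  let ?u = "\<lambda>g. if g = e then 1 else if g = f then -1 else 0 :: rat"
  have "(\<Sum>g\<in>basis_cells n. hscale (?u g) (z_cls g)) = (\<Sum>g\<in>{e, f}. hscale (?u g) (z_cls g))"
    using ef finite_basis_cells by (intro sum.mono_neutral_right) auto
  also have "\<dots> = 0" using ef by simp
  finally have "?u e = 0" using ef(1) by (rule z_cls_cells_independent)
  thus False by simp
qed

lemma independent_z_cls: "hv.independent (z_cls ` basis_cells n)"
proof (rule hv.independent_if_scalars_zero)
  show "finite (z_cls ` basis_cells n)" using finite_basis_cells by simp
  fix f x assume "(\<Sum>x\<in>z_cls ` basis_cells n. hscale (f x) x) = 0" and x: "x \<in> z_cls ` basis_cells n"
  hence "(\<Sum>e\<in>basis_cells n. hscale (f (z_cls e)) (z_cls e)) = 0"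
    by (simp add: sum.reindex[OF inj_on_z_cls])
  from z_cls_cells_independent[OF this] show "f x = 0" using x by blast
qed

lemma homology_subspace: "hv.subspace (homology S k)"
proof (rule hv.subspaceI)
  show "0 \<in> homology S k"
    unfolding homology_def using qs.subspace_0[OF cycles_subspace] cls_zero by (metis imageI)
  show "x + y \<in> homology S k" if "x \<in> homology S k" "y \<in> homology S k" for x y
    using that qs.subspace_add[OF cycles_subspace, of _ S k]
    by (auto simp: homology_def simp flip: cls_add)
  show "hscale q x \<in> homology S k" if "x \<in> homology S k" for q x
    using that qs.subspace_scale[OF cycles_subspace, of _ S k]
    by (auto simp: homology_def simp flip: cls_scale)
qed

lemma span_z_cls: "hv.span (z_cls ` basis_cells n) = H1 n"
proof
  show "hv.span (z_cls ` basis_cells n) \<subseteq> H1 n"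
  proof (rule hv.span_minimal[OF _ homology_subspace], rule image_subsetI)
    fix e assume "e \<in> basis_cells n"
    thus "z_cls e \<in> H1 n" unfolding z_cls_def homology_def by (intro imageI z_chain_cycle)
  qed
  show "H1 n \<subseteq> hv.span (z_cls ` basis_cells n)"
    using homology_subset_loop_span loop_span_subset_span by blast
qed

lemma (in vector_space) independent_if_card_le:
  assumes "independent B" "finite X" "B \<subseteq> span X" "card X \<le> card B"
  shows "independent X"
proof
  assume "dependent X"
  then obtain x where x: "x \<in> X" "x \<in> span (X - {x})" by (auto simp: dependent_def)
  have "span X = span (X - {x})"
    using x by (metis insert_Diff span_redundant)
  with assms have "card B \<le> card (X - {x})"
    using independent_span_bound[of "X - {x}" B] by auto
  thus False using assms(2,4) x(1) card_gt_0_iff[of X] by (auto simp: card_Diff_singleton)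
qed

theorem corollary4p10:
  fixes A' :: "nat \<Rightarrow> nat \<Rightarrow> hclass set" and n :: nat
  assumes "admissible A'"
    and "n \<ge> 3"
  shows "hv.independent ((\<Union>m\<in>{1..n - 2}. A' n m) \<union> (\<Union>m\<in>{0..n - 2}. B_set n m))
    \<and> hv.span ((\<Union>m\<in>{1..n - 2}. A' n m) \<union> (\<Union>m\<in>{0..n - 2}. B_set n m)) = H1 n"
proof -
  let ?X = "(\<Union>m\<in>{1..n - 2}. A' n m) \<union> (\<Union>m\<in>{0..n - 2}. B_set n m)"
  let ?Y = "z_cls ` basis_cells n"
  have adm: "finite (A' n m) \<and> card (A' n m) = card (A_set n m)
     \<and> hv.span (B_set n 0 \<union> (\<Union>l\<in>{1..m}. A' n l \<union> B_set n l))
        = hv.span (B_set n 0 \<union> (\<Union>l\<in>{1..m}. A_set n l \<union> B_set n l))"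
    if "m \<in> {1..n - 2}" for m
    using assms that unfolding admissible_def atLeastAtMost_iff by blast
  have eqs: "A_set n m = z_cls ` A_cells n m" if "m \<in> {1..n - 2}" for m
    using that by (intro A_set_eq) auto
  have eqB: "B_set n m = z_cls ` B_cells n m" if "m \<in> {0..n - 2}" for m
    using that assms(2) by (intro B_set_eq) auto
  have Y: "?Y = (\<Union>m\<in>{1..n - 2}. A_set n m) \<union> (\<Union>m\<in>{0..n - 2}. B_set n m)"
    unfolding basis_cells_def image_Un image_UN using eqs eqB by simp
  have zero: "{0..n - 2} = insert 0 {1..n - 2}" by auto
  have union: "(\<Union>m\<in>{1..n - 2}. C m) \<union> (\<Union>m\<in>{0..n - 2}. B_set n m)
      = B_set n 0 \<union> (\<Union>l\<in>{1..n - 2}. C l \<union> B_set n l)" for C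
    unfolding zero by blast
  have span: "hv.span ?X = hv.span ?Y"
    unfolding Y union using adm[of "n - 2"] assms(2) by simp
  have finB: "finite (B_cells n m)" if "m \<in> {0..n - 2}" for m
    using that assms(2) by (intro finite_cells) auto
  have finA: "finite (A_cells n m)" if "m \<in> {1..n - 2}" for m
    using that by (intro finite_cells) auto
  have finX: "finite ?X"
    using adm finB eqB by simp
  have "card ?X \<le> (\<Sum>m\<in>{1..n - 2}. card (A' n m)) + (\<Sum>m\<in>{0..n - 2}. card (B_set n m))"
    by (intro order_trans[OF card_Un_le] add_mono card_UN_le) auto
  also have "\<dots> \<le> (\<Sum>m\<in>{1..n - 2}. card (A_cells n m)) + (\<Sum>m\<in>{0..n - 2}. card (B_cells n m))"
    using adm eqs eqB finA finB by (intro add_mono sum_mono) (simp_all add: card_image_le)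
  also have "\<dots> = card (basis_cells n)"
    by (rule card_basis_cells[OF finA finB, symmetric])
  also have "\<dots> = card ?Y"
    by (rule card_image[OF inj_on_z_cls, symmetric])
  finally have "card ?X \<le> card ?Y" .
  hence "hv.independent ?X"
    using hv.independent_if_card_le[OF independent_z_cls finX] hv.span_superset[of ?Y] span by simp
  thus ?thesis using span span_z_cls by simp
qed

end
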